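(* Let $\alpha\in(0,1)$, $\mu_1\in\mathcal M^+_\alpha(\mathbb R)$ and $\mu_2\in\mathcal M^+_{1-\alpha}(\mathbb R)$. Then there exists $\mu\in\mathcal M^+_1(\mathbb R)$ such that $$C_\alpha[\mu_1](z)\,C_{1-\alpha}[\mu_2](z)=C_1[\mu](z),\qquad z\in\mathbb C^+,$$ if and only if there exists $a\ge0$ such that $$\int_{[a,\infty)}\int_{(-\infty,-a]}Q_\alpha(|s|,t)\,\mu_1(ds)\,\mu_2(dt)<\infty\quad\text{and}\quad\int_{(-\infty,-a]}\int_{[a,\infty)}Q_\alpha(s,|t|)\,\mu_1(ds)\,\mu_2(dt)<\infty,$$ where $Q_\alpha(x,y)=\int_0^1\frac{d\tau}{(x\tau+1)^\alpha(y\tau+1)^{1-\alpha}}$, $x,y\ge0$.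
   Context: $\mathbb C^+=\{z:\operatorname{Im}z>0\}$. For $\alpha\ge0$, $\mathcal M^+_\alpha(\mathbb R)$ is the set of positive Borel (Radon) measures $\mu$ on $\mathbb R$ with $\int_{\mathbb R}(1+|t|)^{-\alpha}\mu(dt)<\infty$. For $\alpha>0$, $C_\alpha[\mu](z)=\int_{\mathbb R}\frac{\mu(dt)}{(z+t)^\alpha}$, $z\in\mathbb C^+$ (principal branch of the power). *)

theory Defs
  imports "HOL-Analysis.Analysis"
begin

definition Mplus :: "real \<Rightarrow> real measure set" where
  "Mplus \<alpha> = {M. sets M = sets borel \<and>
      (\<integral>\<^sup>+ t. ennreal ((1 + \<bar>t\<bar>) powr (- \<alpha>)) \<partial>M) < \<infinity>}"

text \<open>C_alpha[mu](z) = integral of (z+t)^(-alpha) d mu(t), principal branch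
  (complex powr uses the principal logarithm).\<close>
definition Ctrans :: "real \<Rightarrow> real measure \<Rightarrow> complex \<Rightarrow> complex" where
  "Ctrans \<alpha> M z = (\<integral> t. (z + of_real t) powr (- of_real \<alpha>) \<partial>M)"

definition Qfun :: "real \<Rightarrow> real \<Rightarrow> real \<Rightarrow> real" where
  "Qfun \<alpha> x y = integral {0..1}
     (\<lambda>\<tau>. 1 / ((x * \<tau> + 1) powr \<alpha> * (y * \<tau> + 1) powr (1 - \<alpha>)))"

end

theory Submission
  imports Defs "HOL-Complex_Analysis.Conformal_Mappings"
begin

text \<open>
  Let \<open>\<rho>\<close> be the probability measure on \<open>(0, \<infinity>)\<close> with density proportional to
  \<open>w powr (\<alpha> - 1) / (w + 1)\<close>. Feynman's parametrisation says that the image \<open>\<nu>\<close> of \<open>\<rho>\<close> under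
  \<open>w \<mapsto> (s w + t) / (w + 1)\<close> satisfies
  \<open>\<integral> \<nu>(du) / (z + u) = (z + s) powr (- \<alpha>) * (z + t) powr (\<alpha> - 1)\<close>, so the only candidate for \<open>\<mu>\<close> is
  the mixture of the measures \<open>\<nu>\<close> over \<open>\<mu>2 \<times> \<mu>1\<close>, and the question is whether it integrates
  \<open>1 / (1 + |u|)\<close>.

  This function is comparable to \<open>\<integral>\<^sub>0\<^sup>1 d\<tau> / (1 + u\<^sup>2 \<tau>\<^sup>2)\<close>, whose integrand is \<open>- Im (1 / (z + u)) / \<tau>\<close> at
  \<open>z = \<i> / \<tau>\<close>. On the kernel side \<open>- Im\<close> is the modulus times \<open>sin \<theta>\<close>, where \<open>\<theta>\<close> is the
  \<open>(\<alpha>, 1 - \<alpha>)\<close>-average of the arguments of \<open>z + s\<close> and \<open>z + t\<close>; the modulus is comparable to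
  the integrand of \<open>Q\<close>, and \<open>sin \<theta>\<close> is bounded below when \<open>s\<close> and \<open>t\<close> have opposite signs. By Tonelli
  the opposite sign part is thus governed by \<open>Q\<close>. For equal signs the integral of
  \<open>1 / (1 + |u|)\<close> against \<open>\<nu>\<close> is exactly \<open>(1 + |s|) powr (- \<alpha>) * (1 + |t|) powr (\<alpha> - 1)\<close>, and \<open>Q\<close> is
  bounded by a multiple of the same quantity when \<open>|s|\<close> or \<open>|t|\<close> is bounded by \<open>a\<close>.
\<close>

subsection \<open>The beta measure and Feynman's parametrisation\<close>

text \<open>The weight is cut at 1: below, it is dominated by \<open>w powr (\<alpha> - 1)\<close>,
  integrable at 0 because \<alpha> > 0; above, by \<open>w powr (\<alpha> - 2)\<close>, integrable
  at infinity because \<alpha> < 1. Positivity holds since the weight is positive on the interval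
  (0, 1). Both facts allow the weight to be normalised.\<close>

lemma beta_weight_finite_pos:
  fixes \<alpha> :: real
  assumes "0 < \<alpha>" "\<alpha> < 1"
  defines "C \<equiv> \<integral>\<^sup>+ w. ennreal (indicator {0<..} w * (w powr (\<alpha> - 1) / (w + 1))) \<partial>lborel"
  shows "C < \<infinity>" "0 < C"
proof -
  have 1: "(\<integral>\<^sup>+ w. ennreal (w powr (\<alpha> - 1)) * indicator {0..1} w \<partial>lborel) < \<infinity>"
    using has_integral_powr_from_0[of "\<alpha> - 1" 1] assms
    by (subst nn_integral_has_integral_lebesgue') auto
  have 2: "(\<integral>\<^sup>+ w. ennreal (w powr (\<alpha> - 2)) * indicator {1..} w \<partial>lborel) < \<infinity>"
    using has_integral_powr_to_inf[of "\<alpha> - 2" 1] assms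
    by (subst nn_integral_has_integral_lebesgue') auto
  have "C \<le> (\<integral>\<^sup>+ w. ennreal (w powr (\<alpha> - 1)) * indicator {0..1} w
      + ennreal (w powr (\<alpha> - 2)) * indicator {1..} w \<partial>lborel)"
    unfolding C_def
  proof (rule nn_integral_mono)
    fix w :: real
    have "w powr (\<alpha> - 1) / (w + 1) \<le> w powr (\<alpha> - 1)" if "0 < w"
      using that by (simp add: divide_simps mult_le_cancel_left1)
    moreover have "w powr (\<alpha> - 1) / (w + 1) \<le> w powr (\<alpha> - 2)" if "1 < w"
    proof -
      have "w powr (\<alpha> - 2) = w powr (\<alpha> - 1) / w"
        using that powr_diff[of w "\<alpha> - 1" 1] by (simp add: field_simps)
      also have "w powr (\<alpha> - 1) / (w + 1) \<le> \<dots>"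
        using that by (intro divide_left_mono) auto
      finally show ?thesis .
    qed
    ultimately show "ennreal (indicator {0<..} w * (w powr (\<alpha> - 1) / (w + 1)))
      \<le> ennreal (w powr (\<alpha> - 1)) * indicator {0..1} w + ennreal (w powr (\<alpha> - 2)) * indicator {1..} w"
      using order_trans[OF ennreal_leI, of "w powr (\<alpha> - 1) / (w + 1)" "w powr (\<alpha> - 1)"]
      by (cases "w \<le> 1") (auto simp: indicator_def intro: ennreal_leI add_increasing2)
  qed
  also have "\<dots> < \<infinity>"
    using 1 2 by (subst nn_integral_add) auto
  finally show "C < \<infinity>" .
  have "\<not> (AE w in lborel. ennreal (indicator {0<..} w * (w powr (\<alpha> - 1) / (w + 1))) = 0)"
  proof
    assume "AE w in lborel. ennreal (indicator {0<..} w * (w powr (\<alpha> - 1) / (w + 1))) = 0"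
    then have "AE w in lborel. w \<notin> {0<..<1::real}"
      by eventually_elim (auto simp: indicator_def ennreal_eq_0_iff divide_le_0_iff split: if_splits)
    then have "emeasure lborel {0<..<1::real} = 0"
      using AE_iff_measurable[of "{0<..<1::real}" lborel "\<lambda>w. w \<notin> {0<..<1}"]
      by (simp add: set_eq_iff)
    then show False by simp
  qed
  then show "0 < C"
    unfolding C_def by (subst zero_less_iff_neq_zero) (simp add: nn_integral_0_iff_AE)
qed

text \<open>Substitute \<open>p * w\<close> for \<open>w\<close>: the differential gives p, the
  numerator \<open>p powr (\<alpha> - 1)\<close>, and the denominator 1 / p.\<close>

lemma beta_weight_scaling:
  fixes \<alpha> p :: real
  assumes p: "0 < p"
  shows "(\<integral>\<^sup>+ w. ennreal (indicator {0<..} w * (w powr (\<alpha> - 1) / (w + p))) \<partial>lborel)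
    = ennreal (p powr (\<alpha> - 1)) *
      (\<integral>\<^sup>+ w. ennreal (indicator {0<..} w * (w powr (\<alpha> - 1) / (w + 1))) \<partial>lborel)"
proof -
  have "(\<integral>\<^sup>+ w. ennreal (indicator {0<..} w * (w powr (\<alpha> - 1) / (w + p))) \<partial>lborel)
    = ennreal \<bar>p\<bar> * (\<integral>\<^sup>+ w. ennreal (indicator {0<..} (0 + p * w) *
         ((0 + p * w) powr (\<alpha> - 1) / ((0 + p * w) + p))) \<partial>lborel)"
    using p by (intro nn_integral_real_affine) auto
  also have "\<dots> = (\<integral>\<^sup>+ w. ennreal (p powr (\<alpha> - 1)) *
      ennreal (indicator {0<..} w * (w powr (\<alpha> - 1) / (w + 1))) \<partial>lborel)"
  proof (subst nn_integral_cmult[symmetric], measurable, rule nn_integral_cong)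
    fix w :: real
    have "p * ((p * w) powr (\<alpha> - 1) / (p * w + p)) = p powr (\<alpha> - 1) * (w powr (\<alpha> - 1) / (w + 1))"
      if "0 < w"
    proof -
      have "p * w + p = p * (w + 1)" by (simp add: algebra_simps)
      then show ?thesis using that p by (simp add: powr_mult)
    qed
    then show "ennreal \<bar>p\<bar> * ennreal (indicator {0<..} (0 + p * w) *
         ((0 + p * w) powr (\<alpha> - 1) / ((0 + p * w) + p)))
      = ennreal (p powr (\<alpha> - 1)) * ennreal (indicator {0<..} w * (w powr (\<alpha> - 1) / (w + 1)))"
      using p by (auto simp: indicator_def zero_less_mult_iff simp flip: ennreal_mult')
  qed
  also have "\<dots> = ennreal (p powr (\<alpha> - 1)) *
      (\<integral>\<^sup>+ w. ennreal (indicator {0<..} w * (w powr (\<alpha> - 1) / (w + 1))) \<partial>lborel)"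
    by (rule nn_integral_cmult) measurable
  finally show ?thesis .
qed

text \<open>The weight divided by its total mass \<open>C\<close> serves as density. The numerator
  \<open>w + 1\<close> cancels the denominator of the density, so the last property is the scaling
  law.\<close>

lemma beta_measure_exists:
  fixes \<alpha> :: real
  assumes "0 < \<alpha>" "\<alpha> < 1"
  obtains \<rho> :: "real measure" where "sets \<rho> = sets borel" "emeasure \<rho> (space \<rho>) = 1"
    "AE w in \<rho>. 0 < w"
    "\<And>p. 0 < p \<Longrightarrow> (\<integral>\<^sup>+ w. ennreal ((w + 1) / (w + p)) \<partial>\<rho>) = ennreal (p powr (\<alpha> - 1))"
proof -
  define C where "C = (\<integral>\<^sup>+ w. ennreal (indicator {0<..} w * (w powr (\<alpha> - 1) / (w + 1))) \<partial>lborel)"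
  have C: "C < \<infinity>" "0 < C"
    using beta_weight_finite_pos[OF assms] by (auto simp: C_def)
  define g where "g w = ennreal (indicator {0<..} w * (w powr (\<alpha> - 1) / (w + 1))) / C" for w :: real
  have g [measurable]: "g \<in> borel_measurable borel"
    unfolding g_def by measurable
  define \<rho> where "\<rho> = density lborel g"
  have int: "(\<integral>\<^sup>+ w. ennreal ((w + 1) / (w + p)) \<partial>\<rho>) = ennreal (p powr (\<alpha> - 1))" if "0 < p" for p
  proof -
    have "(\<integral>\<^sup>+ w. ennreal ((w + 1) / (w + p)) \<partial>\<rho>)
        = (\<integral>\<^sup>+ w. ennreal (indicator {0<..} w * (w powr (\<alpha> - 1) / (w + p))) / C \<partial>lborel)"
      unfolding \<rho>_def
    proof (subst nn_integral_density, measurable, rule nn_integral_cong)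
      fix w :: real
      have "ennreal (w powr (\<alpha> - 1) / (w + 1)) * ennreal ((w + 1) / (w + p)) = ennreal (w powr (\<alpha> - 1) / (w + p))"
        if "0 < w" using that \<open>0 < p\<close> by (simp flip: ennreal_mult)
      then show "g w * ennreal ((w + 1) / (w + p))
         = ennreal (indicator {0<..} w * (w powr (\<alpha> - 1) / (w + p))) / C"
        unfolding g_def by (auto simp: indicator_def ennreal_times_divide mult.commute)
    qed
    also have "\<dots> = (\<integral>\<^sup>+ w. ennreal (indicator {0<..} w * (w powr (\<alpha> - 1) / (w + p))) \<partial>lborel) / C"
      by (rule nn_integral_divide) measurable
    also have "\<dots> = ennreal (p powr (\<alpha> - 1)) * C / C"
      unfolding C_def using beta_weight_scaling[OF that] by simp
    also have "\<dots> = ennreal (p powr (\<alpha> - 1))"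
      using C by (intro ennreal_mult_divide_eq) auto
    finally show ?thesis .
  qed
  show ?thesis
  proof
    show "sets \<rho> = sets borel" by (simp add: \<rho>_def)
    show AE: "AE w in \<rho>. 0 < w"
      unfolding \<rho>_def by (subst AE_density) (auto simp: g_def indicator_def)
    \<comment> \<open>The total mass is the case p = 1 of the integral just computed.\<close>
    have "emeasure \<rho> (space \<rho>) = (\<integral>\<^sup>+ w. 1 \<partial>\<rho>)" by simp
    also have "\<dots> = (\<integral>\<^sup>+ w. ennreal ((w + 1) / (w + 1)) \<partial>\<rho>)"
      using AE by (intro nn_integral_cong_AE) auto
    also have "\<dots> = 1" using int[of 1] by simp
    finally show "emeasure \<rho> (space \<rho>) = 1" .
  qed (fact int)
qed

text \<open>With \<open>r = |p|\<close> and \<open>c = Re p / r\<close> one has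
  \<open>|w + p|^2 - (w + r)^2 (1 + c) / 2 = (w - r)^2 (1 - c) / 2 \<ge> 0\<close>.\<close>
lemma norm_add_ge_slit_plane:
  fixes p :: complex
  assumes "p \<notin> \<real>\<^sub>\<le>\<^sub>0"
  obtains d where "0 < d" "\<And>w::real. 0 \<le> w \<Longrightarrow> d * (w + 1) \<le> norm (of_real w + p)"
proof -
  define r where "r = norm p"
  define c where "c = Re p / r"
  have "p \<noteq> 0" using assms by auto
  then have r: "0 < r" by (simp add: r_def)
  have Rep: "Re p = c * r" using r by (simp add: c_def)
  have c: "-1 < c" "c \<le> 1"
  proof -
    have "\<bar>Re p\<bar> \<le> r" by (simp add: r_def abs_Re_le_cmod)
    then show "c \<le> 1" using r by (auto simp: c_def divide_simps)
    have "Re p \<noteq> - r"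
    proof
      assume "Re p = - r"
      moreover have "r\<^sup>2 = (Re p)\<^sup>2 + (Im p)\<^sup>2" by (simp add: r_def cmod_power2)
      ultimately have "Im p = 0" "Re p \<le> 0" using r by auto
      then show False using assms by (simp add: complex_nonpos_Reals_iff)
    qed
    then show "-1 < c" using \<open>\<bar>Re p\<bar> \<le> r\<close> r by (auto simp: c_def divide_simps)
  qed
  \<comment> \<open>The square root comes from dropping the nonnegative term
    \<open>(1 - c) / 2 * (w - r)\<^sup>2\<close>; the factor \<open>min 1 r\<close> replaces
    \<open>w + r\<close> by \<open>w + 1\<close>. The root is positive because p is off the slit,
    that is, c > -1.\<close>
  define d where "d = sqrt ((1 + c) / 2) * min 1 r"
  have "0 < d" using c r by (simp add: d_def)
  moreover have "d * (w + 1) \<le> norm (of_real w + p)" if "0 \<le> w" for w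
  proof -
    have "d * (w + 1) \<le> sqrt ((1 + c) / 2) * (w + r)"
    proof -
      have "min 1 r * (w + 1) = min 1 r * w + min 1 r" by (simp add: algebra_simps)
      also have "\<dots> \<le> w + r" using that r by (intro add_mono) (auto intro: mult_left_le_one_le)
      finally show ?thesis unfolding d_def mult.assoc using c by (intro mult_left_mono) auto
    qed
    also have "\<dots> = sqrt ((1 + c) / 2 * (w + r)\<^sup>2)"
      using that r by (simp only: real_sqrt_mult real_sqrt_abs abs_of_nonneg add_nonneg_nonneg less_imp_le)
    also have "\<dots> \<le> norm (of_real w + p)"
    proof (rule real_le_lsqrt)
      have "(norm (of_real w + p))\<^sup>2 = w\<^sup>2 + 2 * w * Re p + r\<^sup>2"
        unfolding r_def cmod_power2 by (simp add: power2_eq_square algebra_simps)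
      also have "\<dots> = (1 + c) / 2 * (w + r)\<^sup>2 + (1 - c) / 2 * (w - r)\<^sup>2"
        by (simp add: Rep power2_eq_square field_simps)
      also have "\<dots> \<ge> (1 + c) / 2 * (w + r)\<^sup>2" using c by simp
      finally show "(1 + c) / 2 * (w + r)\<^sup>2 \<le> (norm (of_real w + p))\<^sup>2" .
    qed auto
    finally show ?thesis .
  qed
  ultimately show ?thesis by (rule that)
qed

section \<open>Analytic continuation of the Stieltjes integral to the slit plane\<close>

text \<open>Differentiation under the integral sign. The lower bound \<open>d * (w + 1)\<close> for
  the denominator makes the integrand \<open>f\<close> and its p-derivative \<open>h\<close>
  bounded, hence integrable for a finite measure, and it bounds the error of the difference quotient
  by a multiple of \<open>norm (q - p)\<close> uniformly in w.\<close>

lemma Stieltjes_ratio_holomorphic: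
  fixes \<rho> :: "real measure" and p :: complex
  assumes sets [measurable_cong]: "sets \<rho> = sets borel" and fin: "emeasure \<rho> (space \<rho>) \<noteq> \<infinity>"
    and pos: "AE w in \<rho>. 0 < w"
  shows "(\<lambda>p. \<integral>w. of_real (w + 1) / (of_real w + p) \<partial>\<rho>) holomorphic_on (- \<real>\<^sub>\<le>\<^sub>0)"
    and "p \<notin> \<real>\<^sub>\<le>\<^sub>0 \<Longrightarrow> integrable \<rho> (\<lambda>w. of_real (w + 1) / (of_real w + p))"
proof -
  interpret finite_measure \<rho> by (rule finite_measureI) (use fin in auto)
  define f where "f p w = of_real (w + 1) / (of_real w + p)" for p :: complex and w :: real
  define h where "h p w = - of_real (w + 1) / (of_real w + p)\<^sup>2" for p :: complex and w :: real
  have [measurable]: "f p \<in> borel_measurable borel" "h p \<in> borel_measurable borel" for p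
    unfolding f_def h_def by measurable
  have intf: "integrable \<rho> (f p)" and inth: "integrable \<rho> (h p)" if p: "p \<notin> \<real>\<^sub>\<le>\<^sub>0" for p
  proof -
    obtain d where d: "0 < d" "\<And>w::real. 0 \<le> w \<Longrightarrow> d * (w + 1) \<le> norm (of_real w + p)"
      using norm_add_ge_slit_plane[OF p] by metis
    have w1: "norm (complex_of_real (w + 1)) = w + 1" if "0 < w" for w
      using that by (subst norm_of_real) simp
    show "integrable \<rho> (f p)"
    proof (rule integrable_const_bound[where B = "1 / d"])
      show "AE w in \<rho>. norm (f p w) \<le> 1 / d"
        using pos
      proof eventually_elim
        case (elim w)
        have 0: "0 < d * (w + 1)" using elim d by simp
        then have "norm (f p w) \<le> (w + 1) / (d * (w + 1))"
          unfolding f_def norm_divide w1[OF elim] using d(2)[of w] 0 elim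
          by (intro frac_le) auto
        then show ?case using elim d(1) by simp
      qed
    qed measurable
    show "integrable \<rho> (h p)"
    proof (rule integrable_const_bound[where B = "1 / d\<^sup>2"])
      show "AE w in \<rho>. norm (h p w) \<le> 1 / d\<^sup>2"
        using pos
      proof eventually_elim
        case (elim w)
        have 0: "0 < d * (w + 1)" using elim d by simp
        have "(d * (w + 1))\<^sup>2 \<le> (norm (of_real w + p))\<^sup>2"
          using d(2)[of w] elim 0 by (intro power_mono) auto
        then have "norm (h p w) \<le> (w + 1) / (d * (w + 1))\<^sup>2"
          using 0 elim by (auto simp: h_def norm_divide norm_power w1 norm_minus_commute
              simp del: power_mult_distrib of_real_add intro!: divide_left_mono mult_pos_pos zero_less_power)
        also have "\<dots> = 1 / d\<^sup>2 * (1 / (w + 1))"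
          using elim by (simp add: power2_eq_square)
        also have "\<dots> \<le> 1 / d\<^sup>2 * 1"
          using elim by (intro mult_left_mono) auto
        finally show ?case by simp
      qed
    qed measurable
  qed
  then show "p \<notin> \<real>\<^sub>\<le>\<^sub>0 \<Longrightarrow> integrable \<rho> (\<lambda>w. of_real (w + 1) / (of_real w + p))"
    by (simp only: f_def[abs_def])
  have "((\<lambda>p. \<integral>w. f p w \<partial>\<rho>) has_field_derivative (\<integral>w. h p w \<partial>\<rho>)) (at p)" if p: "p \<notin> \<real>\<^sub>\<le>\<^sub>0" for p
  proof -
    obtain d where d: "0 < d" "\<And>w::real. 0 \<le> w \<Longrightarrow> d * (w + 1) \<le> norm (of_real w + p)"
      using norm_add_ge_slit_plane[OF p] by metis
    define K where "K = measure \<rho> (space \<rho>) * (2 / d ^ 3)"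
    have bound: "norm (((\<integral>w. f q w \<partial>\<rho>) - (\<integral>w. f p w \<partial>\<rho>)) / (q - p) - (\<integral>w. h p w \<partial>\<rho>)) \<le> K * norm (q - p)"
      if q: "q \<noteq> p" "norm (q - p) < d / 2" "q \<notin> \<real>\<^sub>\<le>\<^sub>0" for q
    proof -
      have "((\<integral>w. f q w \<partial>\<rho>) - (\<integral>w. f p w \<partial>\<rho>)) / (q - p) - (\<integral>w. h p w \<partial>\<rho>)
          = (\<integral>w. (f q w - f p w) / (q - p) - h p w \<partial>\<rho>)"
        using intf[OF p] intf[OF q(3)] inth[OF p] by simp
      also have "norm \<dots> \<le> (\<integral>w. norm ((f q w - f p w) / (q - p) - h p w) \<partial>\<rho>)"
        by (rule integral_norm_bound)
      also have "\<dots> \<le> (\<integral>w. 2 / d ^ 3 * norm (q - p) \<partial>\<rho>)"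
      proof (rule integral_mono_AE)
        show "integrable \<rho> (\<lambda>w. norm ((f q w - f p w) / (q - p) - h p w))"
          using intf[OF p] intf[OF q(3)] inth[OF p] by simp
        show "AE w in \<rho>. norm ((f q w - f p w) / (q - p) - h p w) \<le> 2 / d ^ 3 * norm (q - p)"
          using pos
        proof eventually_elim
          case (elim w)
          define W where "W = complex_of_real (w + 1)"
          define P where "P = of_real w + p"
          define Q where "Q = of_real w + q"
          have W: "norm W = w + 1" using elim unfolding W_def by (subst norm_of_real) simp
          have P: "d * (w + 1) \<le> norm P" using d(2)[of w] elim by (simp add: P_def)
          have "norm P \<le> norm Q + norm (q - p)"
            using norm_triangle_ineq4[of Q "q - p"] by (simp add: P_def Q_def)
          \<comment> \<open>Since \<open>w + 1\<close> is at least 1, half of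
            \<open>d * (w + 1)\<close> absorbs the perturbation
            \<open>norm (q - p) < d / 2\<close>.\<close>
          moreover have "d * 1 \<le> d * (w + 1)" using elim d(1) by (intro mult_left_mono) auto
          ultimately have Q: "d / 2 * (w + 1) \<le> norm Q" using P q(2) by simp
          have 0: "0 < d * (w + 1)" using elim d by simp
          have nz: "P \<noteq> 0" "Q \<noteq> 0" using P Q 0 by auto
          have qp: "q - p = Q - P" "Q - P \<noteq> 0" using q(1) by (auto simp: P_def Q_def)
          \<comment> \<open>The difference quotient of 1 / P is -1 / (P Q); adding 1 / P^2 leaves
            one factor Q - P in the numerator.\<close>
          have "(f q w - f p w) / (q - p) - h p w = W * (q - p) / (P\<^sup>2 * Q)"
            unfolding f_def h_def W_def[symmetric] P_def[symmetric] Q_def[symmetric] qp(1)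
            using nz qp(2) by (simp add: divide_simps power2_eq_square) (simp add: algebra_simps)
          then have "norm ((f q w - f p w) / (q - p) - h p w) = (w + 1) * norm (q - p) / ((norm P)\<^sup>2 * norm Q)"
            by (simp add: norm_divide norm_mult norm_power W)
          also have "\<dots> \<le> (w + 1) * norm (q - p) / ((d * (w + 1))\<^sup>2 * (d / 2 * (w + 1)))"
          proof (intro divide_left_mono mult_mono power_mono P Q)
            show "0 < (norm P)\<^sup>2 * norm Q * ((d * (w + 1))\<^sup>2 * (d / 2 * (w + 1)))"
              using nz elim d(1) by (intro mult_pos_pos zero_less_power) auto
          qed (use elim d(1) in auto)
          also have "\<dots> = 2 / d ^ 3 * norm (q - p) * (1 / (w + 1)\<^sup>2)"
          proof -
            have "v * n / ((d * v)\<^sup>2 * (d / 2 * v)) = 2 / d ^ 3 * n * (1 / v\<^sup>2)" if "0 < v" for v n :: real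
              using that d(1) by (simp add: field_simps power2_eq_square power3_eq_cube)
            then show ?thesis using elim by simp
          qed
          also have "\<dots> \<le> 2 / d ^ 3 * norm (q - p) * 1"
            using elim d(1) by (intro mult_left_mono) (auto simp: divide_simps)
          finally show ?case by simp
        qed
      qed simp
      also have "\<dots> = K * norm (q - p)" by (simp add: K_def)
      finally show ?thesis .
    qed
    show ?thesis
      unfolding has_field_derivative_iff
    proof (rule LIM_zero_cancel, rule Lim_null_comparison)
      show "((\<lambda>q. K * norm (q - p)) \<longlongrightarrow> 0) (at p)"
        by (auto intro!: tendsto_eq_intros)
      have "\<forall>\<^sub>F q in at p. q \<noteq> p \<and> dist q p < d / 2 \<and> q \<in> - \<real>\<^sub>\<le>\<^sub>0"
        using p d(1) eventually_at_in_open'[of "- \<real>\<^sub>\<le>\<^sub>0" p]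
        by (intro eventually_conj eventually_neq_at_within)
          (auto simp: open_Compl eventually_at intro!: exI[of _ "d / 2"])
      then show "\<forall>\<^sub>F q in at p. norm (((\<integral>w. f q w \<partial>\<rho>) - (\<integral>w. f p w \<partial>\<rho>)) / (q - p) - (\<integral>w. h p w \<partial>\<rho>))
          \<le> K * norm (q - p)"
        by eventually_elim (auto simp: dist_norm intro!: bound)
    qed
  qed
  then show "(\<lambda>p. \<integral>w. of_real (w + 1) / (of_real w + p) \<partial>\<rho>) holomorphic_on (- \<real>\<^sub>\<le>\<^sub>0)"
    unfolding holomorphic_on_def field_differentiable_def f_def[abs_def]
    by (auto simp del: of_real_add intro: has_field_derivative_at_within)
qed

text \<open>Identity theorem: both sides are holomorphic on the slit plane, which is connected
  because it is starlike, and they agree on the positive reals, which accumulate at 1.\<close>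

lemma beta_measure_Stieltjes:
  fixes \<rho> :: "real measure" and p :: complex
  assumes sets [measurable_cong]: "sets \<rho> = sets borel" and fin: "emeasure \<rho> (space \<rho>) \<noteq> \<infinity>"
    and pos: "AE w in \<rho>. 0 < w"
    and real: "\<And>p. 0 < p \<Longrightarrow> (\<integral>\<^sup>+ w. ennreal ((w + 1) / (w + p)) \<partial>\<rho>) = ennreal (p powr (\<alpha> - 1))"
    and p: "p \<notin> \<real>\<^sub>\<le>\<^sub>0"
  shows "(\<integral>w. of_real (w + 1) / (of_real w + p) \<partial>\<rho>) = p powr (of_real (\<alpha> - 1))"
proof -
  define F where "F p = (\<integral>w. of_real (w + 1) / (of_real w + p) \<partial>\<rho>) - p powr (of_real (\<alpha> - 1))" for p :: complex
  have "F p = 0"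
  proof (rule analytic_continuation[where f = F and w = p and S = "- \<real>\<^sub>\<le>\<^sub>0" and U = "of_real ` {0<..}" and \<xi> = 1])
    show "F holomorphic_on - \<real>\<^sub>\<le>\<^sub>0"
      unfolding F_def by (intro holomorphic_intros Stieltjes_ratio_holomorphic sets fin pos) auto
    have "(\<real>\<^sub>\<le>\<^sub>0 :: complex set) = of_real ` {..0}"
      by (auto elim!: nonpos_Reals_cases)
    then show "connected (- \<real>\<^sub>\<le>\<^sub>0 :: complex set)"
      by (metis starlike_imp_connected starlike_slotted_complex_plane_left)
    show "(1 :: complex) islimpt of_real ` {0<..}"
    proof -
      have "(1::real) islimpt {0<..}" by (intro interior_limit_point) (simp add: interior_open)
      then have "complex_of_real 1 islimpt of_real ` {0<..}"
        by (rule islimpt_isCont_image) (auto intro: eventually_neq_at_within simp: eventually_at_filter)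
      then show ?thesis by simp
    qed
    fix z :: complex assume "z \<in> of_real ` {0<..}"
    then obtain x where z: "z = of_real x" and x: "0 < x" by auto
    have "(\<integral>w. (w + 1) / (w + x) \<partial>\<rho>) = x powr (\<alpha> - 1)"
      using x real[OF x] pos
      by (intro integral_eq_nn_integral[THEN trans]) (auto elim!: eventually_mono)
    moreover have "(\<integral>w. of_real (w + 1) / (of_real w + complex_of_real x) \<partial>\<rho>) = of_real (\<integral>w. (w + 1) / (w + x) \<partial>\<rho>)"
      by (subst integral_complex_of_real[symmetric]) (simp only: of_real_add of_real_divide)
    ultimately show "F z = 0"
      unfolding F_def z using powr_of_real[of x "\<alpha> - 1"] x by (simp del: of_real_add of_real_diff)
  next
    show "complex_of_real ` {0<..} \<subseteq> - \<real>\<^sub>\<le>\<^sub>0" by (auto simp: complex_nonpos_Reals_iff)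
  qed (use p in \<open>simp_all add: open_Compl complex_nonpos_Reals_iff\<close>)
  then show ?thesis by (simp add: F_def)
qed

text \<open>Dividing the denominator by A reduces the integral to the Stieltjes integral at p = B /
  A. The resulting power of B / A splits into powers of A and B because both points lie in the upper
  half-plane.\<close>

lemma beta_measure_Feynman:
  fixes \<rho> :: "real measure" and A B :: complex
  assumes sets [measurable_cong]: "sets \<rho> = sets borel" and fin: "emeasure \<rho> (space \<rho>) \<noteq> \<infinity>"
    and pos: "AE w in \<rho>. 0 < w"
    and real: "\<And>p. 0 < p \<Longrightarrow> (\<integral>\<^sup>+ w. ennreal ((w + 1) / (w + p)) \<partial>\<rho>) = ennreal (p powr (\<alpha> - 1))"
    and A: "0 < Im A" and B: "0 < Im B"
  shows "integrable \<rho> (\<lambda>w. of_real (w + 1) / (of_real w * A + B))"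
    and "(\<integral>w. of_real (w + 1) / (of_real w * A + B) \<partial>\<rho>) = A powr (- of_real \<alpha>) * B powr (- of_real (1 - \<alpha>))"
proof -
  have A0: "A \<noteq> 0" and B0: "B \<noteq> 0" using A B by auto
  \<comment> \<open>Both arguments lie in (0, pi), so their difference lies in (-pi, pi) and no
    multiple of 2 pi appears.\<close>
  have Ln: "Ln (B / A) = Ln B - Ln A"
    using Im_Ln_pos_lt_imp[OF A] Im_Ln_pos_lt_imp[OF B] A0 B0
    by (intro Ln_unique) (auto simp: exp_diff)
  have p: "B / A \<notin> \<real>\<^sub>\<le>\<^sub>0"
  proof
    assume "B / A \<in> \<real>\<^sub>\<le>\<^sub>0"
    then obtain x where "B / A = of_real x" "x \<le> 0" by (auto elim: nonpos_Reals_cases)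
    then have "B = of_real x * A" using A0 by (simp add: field_simps)
    then show False using A B \<open>x \<le> 0\<close> by (simp add: zero_less_mult_iff)
  qed
  have eq: "of_real (w + 1) / (of_real w * A + B) = inverse A * (of_real (w + 1) / (of_real w + B / A))" for w
  proof -
    have "of_real w * A + B = A * (of_real w + B / A)" using A0 by (simp add: field_simps)
    then show ?thesis by (simp add: divide_inverse mult_ac)
  qed
  show "integrable \<rho> (\<lambda>w. of_real (w + 1) / (of_real w * A + B))"
    unfolding eq by (intro integrable_mult_right Stieltjes_ratio_holomorphic sets fin pos p)
  have "(\<integral>w. of_real (w + 1) / (of_real w * A + B) \<partial>\<rho>) = inverse A * (B / A) powr (of_real (\<alpha> - 1))"
    unfolding eq by (subst integral_mult_right_zero) (simp only: beta_measure_Stieltjes[OF sets fin pos real p])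
  also have "inverse A = exp (- Ln A)" using A0 by (simp add: exp_minus)
  also have "(B / A) powr (of_real (\<alpha> - 1)) = exp (of_real (\<alpha> - 1) * (Ln B - Ln A))"
    using A0 B0 by (simp add: powr_def Ln)
  also have "exp (- Ln A) * \<dots> = exp (- of_real \<alpha> * Ln A) * exp (- of_real (1 - \<alpha>) * Ln B)"
    by (simp add: exp_add[symmetric] algebra_simps)
  also have "\<dots> = A powr (- of_real \<alpha>) * B powr (- of_real (1 - \<alpha>))"
    using A0 B0 by (simp add: powr_def)
  finally show "(\<integral>w. of_real (w + 1) / (of_real w * A + B) \<partial>\<rho>) = A powr (- of_real \<alpha>) * B powr (- of_real (1 - \<alpha>))" .
qed

subsection \<open>Measures with a power weight\<close>

text \<open>Neither z nor -z meets the slit, so the slit plane bound applies to z for t \<ge> 0 and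
  to -z for t < 0.\<close>

lemma norm_add_real_ge_upper_half_plane:
  assumes z: "0 < Im z"
  obtains d where "0 < d" "\<And>t::real. d * (1 + \<bar>t\<bar>) \<le> norm (z + of_real t)"
proof -
  have "z \<notin> \<real>\<^sub>\<le>\<^sub>0" "- z \<notin> \<real>\<^sub>\<le>\<^sub>0" using z by (auto simp: complex_nonpos_Reals_iff)
  then obtain a b where a: "0 < a" "\<And>w::real. 0 \<le> w \<Longrightarrow> a * (w + 1) \<le> norm (of_real w + z)"
    and b: "0 < b" "\<And>w::real. 0 \<le> w \<Longrightarrow> b * (w + 1) \<le> norm (of_real w + - z)"
    by (metis norm_add_ge_slit_plane)
  show ?thesis
  proof (rule that[of "min a b"])
    fix t :: real
    show "min a b * (1 + \<bar>t\<bar>) \<le> norm (z + of_real t)"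
    proof (cases "0 \<le> t")
      case True
      have "min a b * (1 + t) \<le> a * (1 + t)" using True by (intro mult_right_mono) auto
      also have "\<dots> \<le> norm (z + of_real t)" using a(2)[OF True] by (simp only: add.commute)
      finally show ?thesis using True by simp
    next
      case False
      then have "min a b * (1 - t) \<le> b * (1 - t)" by (intro mult_right_mono) auto
      also have "\<dots> \<le> norm (of_real (- t) + - z)" using b(2)[of "- t"] False by (simp add: add.commute)
      also have "\<dots> = norm (z + of_real t)"
        using norm_minus_cancel[of "z + of_real t"] by (simp add: add.commute)
      finally show ?thesis using False by simp
    qed
  qed (use a b in auto)
qed

text \<open>Multiplying by the weight gives a finite measure \<open>N\<close>, and the measure is
  recovered from \<open>N\<close> through the reciprocal weight, a density with finite
  values.\<close>

lemma Mplus_sigma_finite: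
  assumes "M \<in> Mplus \<beta>"
  shows "sigma_finite_measure M"
proof -
  have sets [measurable_cong]: "sets M = sets borel"
    and fin: "(\<integral>\<^sup>+ t. ennreal ((1 + \<bar>t\<bar>) powr - \<beta>) \<partial>M) < \<infinity>"
    using assms by (auto simp: Mplus_def)
  define N where "N = density M (\<lambda>t. ennreal ((1 + \<bar>t\<bar>) powr - \<beta>))"
  interpret N: finite_measure N
    using fin by (intro finite_measureI) (auto simp: N_def emeasure_density cong: nn_integral_cong)
  have "density N (\<lambda>t. ennreal ((1 + \<bar>t\<bar>) powr \<beta>)) = density M (\<lambda>_. 1)"
    unfolding N_def
    by (subst density_density_eq)
      (auto simp: powr_minus ennreal_mult[symmetric] intro!: density_cong)
  also have "\<dots> = M" by (simp add: density_1)
  finally have M: "M = density N (\<lambda>t. ennreal ((1 + \<bar>t\<bar>) powr \<beta>))" ..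
  have "sigma_finite_measure (density N (\<lambda>t. ennreal ((1 + \<bar>t\<bar>) powr \<beta>)))"
    by (subst N.sigma_finite_iff_density_finite) (auto simp: N_def)
  then show ?thesis using M by simp
qed

lemma powr_measurable_complex [measurable]:
  fixes f :: "'a \<Rightarrow> complex"
  assumes [measurable]: "f \<in> borel_measurable M"
  shows "(\<lambda>x. f x powr c) \<in> borel_measurable M"
  unfolding powr_def by measurable

lemma Mplus_integrable_powr:
  assumes M: "M \<in> Mplus \<beta>" and "0 \<le> \<beta>" and z: "0 < Im z"
  shows "integrable M (\<lambda>t. (z + of_real t) powr (- of_real \<beta>))"
proof -
  have sets [measurable_cong]: "sets M = sets borel"
    and fin: "(\<integral>\<^sup>+ t. ennreal ((1 + \<bar>t\<bar>) powr - \<beta>) \<partial>M) < \<infinity>"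
    using M by (auto simp: Mplus_def)
  obtain d where d: "0 < d" "\<And>t::real. d * (1 + \<bar>t\<bar>) \<le> norm (z + of_real t)"
    using norm_add_real_ge_upper_half_plane[OF z] by metis
  have "integrable M (\<lambda>t. (1 + \<bar>t\<bar>) powr - \<beta>)"
    by (intro integrableI_nonneg) (use fin in auto)
  then have "integrable M (\<lambda>t. d powr - \<beta> * (1 + \<bar>t\<bar>) powr - \<beta>)"
    by simp
  then show ?thesis
  proof (rule Bochner_Integration.integrable_bound)
    show "AE t in M. norm ((z + of_real t) powr (- of_real \<beta>)) \<le> norm (d powr - \<beta> * (1 + \<bar>t\<bar>) powr - \<beta>)"
    proof (rule AE_I2)
      fix t
      have "norm ((z + of_real t) powr (- of_real \<beta>)) = norm (z + of_real t) powr - \<beta>"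
        by (subst norm_powr_real_powr') auto
      also have "\<dots> \<le> (d * (1 + \<bar>t\<bar>)) powr - \<beta>"
        using d \<open>0 \<le> \<beta>\<close> by (intro powr_mono2') auto
      also have "\<dots> = d powr - \<beta> * (1 + \<bar>t\<bar>) powr - \<beta>"
        using d(1) by (simp add: powr_mult)
      finally show "norm ((z + of_real t) powr (- of_real \<beta>)) \<le> norm (d powr - \<beta> * (1 + \<bar>t\<bar>) powr - \<beta>)"
        by simp
    qed
  qed measurable
qed

subsection \<open>The kernel on the imaginary axis\<close>

text \<open>For x \<ge> 0 one has 1 + x^2 \<le> (1 + x)^2 \<le> 2 (1 + x^2). With x = |u| \<tau> the
  middle term is integrated exactly: 1 / (1 + |u| \<tau>)^2 has the antiderivative \<tau> / (1 + |u|
  \<tau>), so its integral is 1 / (1 + |u|).\<close>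

lemma nn_integral_inverse_quadratic:
  fixes u :: real
  shows "ennreal (1 / (1 + \<bar>u\<bar>)) \<le> (\<integral>\<^sup>+ \<tau>. ennreal (1 / (1 + (u * \<tau>)\<^sup>2)) * indicator {0..1} \<tau> \<partial>lborel)"
    and "(\<integral>\<^sup>+ \<tau>. ennreal (1 / (1 + (u * \<tau>)\<^sup>2)) * indicator {0..1} \<tau> \<partial>lborel) \<le> ennreal (2 / (1 + \<bar>u\<bar>))"
proof -
  have 1: "(\<integral>\<^sup>+ \<tau>. ennreal (1 / (1 + \<bar>u\<bar> * \<tau>)\<^sup>2) * indicator {0..1} \<tau> \<partial>lborel) = ennreal (1 / (1 + \<bar>u\<bar>))"
  proof -
    have nz: "1 + \<bar>u\<bar> * x \<noteq> 0" if "0 \<le> x" for x :: real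
    proof -
      have "0 \<le> \<bar>u\<bar> * x" using that by simp
      then show ?thesis by linarith
    qed
    have "(\<integral>\<^sup>+ \<tau>. ennreal (1 / (1 + \<bar>u\<bar> * \<tau>)\<^sup>2) * indicator {0..1} \<tau> \<partial>lborel)
      = 1 / (1 + \<bar>u\<bar> * 1) - 0 / (1 + \<bar>u\<bar> * 0)"
      by (rule nn_integral_FTC_Icc[where F = "\<lambda>x. x / (1 + \<bar>u\<bar> * x)"])
        (use nz in \<open>auto intro!: derivative_eq_intros simp: power2_eq_square field_simps\<close>)
    then show ?thesis by simp
  qed
  have sq: "(u * \<tau>)\<^sup>2 = (\<bar>u\<bar> * \<tau>)\<^sup>2" for \<tau>
    by (simp add: power_mult_distrib)
  have a: "1 / (1 + \<bar>u\<bar> * \<tau>)\<^sup>2 \<le> 1 / (1 + (u * \<tau>)\<^sup>2)" if "0 \<le> \<tau>" for \<tau>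
  proof (rule divide_left_mono)
    have "0 \<le> \<bar>u\<bar> * \<tau>" using that by simp
    then show "1 + (u * \<tau>)\<^sup>2 \<le> (1 + \<bar>u\<bar> * \<tau>)\<^sup>2"
      unfolding sq by (simp add: power2_eq_square algebra_simps)
    show "0 < (1 + \<bar>u\<bar> * \<tau>)\<^sup>2 * (1 + (u * \<tau>)\<^sup>2)"
      using \<open>0 \<le> \<bar>u\<bar> * \<tau>\<close> by (intro mult_pos_pos zero_less_power add_pos_nonneg) auto
  qed simp
  have b: "1 / (1 + (u * \<tau>)\<^sup>2) \<le> 2 * (1 / (1 + \<bar>u\<bar> * \<tau>)\<^sup>2)" if "0 \<le> \<tau>" for \<tau>
  proof -
    have 0: "0 \<le> \<bar>u\<bar> * \<tau>" using that by simp
    have "(1 + \<bar>u\<bar> * \<tau>)\<^sup>2 + (1 - \<bar>u\<bar> * \<tau>)\<^sup>2 = 2 * (1 + (u * \<tau>)\<^sup>2)"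
      unfolding sq by (simp add: power2_eq_square algebra_simps)
    then have "(1 + \<bar>u\<bar> * \<tau>)\<^sup>2 \<le> 2 * (1 + (u * \<tau>)\<^sup>2)"
      by (metis le_add_same_cancel1 zero_le_power2)
    moreover have "0 < (1 + \<bar>u\<bar> * \<tau>)\<^sup>2" "0 < 1 + (u * \<tau>)\<^sup>2"
      using 0 by (auto intro: add_pos_nonneg)
    ultimately show ?thesis by (simp add: divide_simps)
  qed
  show "ennreal (1 / (1 + \<bar>u\<bar>)) \<le> (\<integral>\<^sup>+ \<tau>. ennreal (1 / (1 + (u * \<tau>)\<^sup>2)) * indicator {0..1} \<tau> \<partial>lborel)"
    unfolding 1[symmetric] using a by (intro nn_integral_mono) (auto simp: indicator_def intro: ennreal_leI)
  have "(\<integral>\<^sup>+ \<tau>. ennreal (1 / (1 + (u * \<tau>)\<^sup>2)) * indicator {0..1} \<tau> \<partial>lborel)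
    \<le> (\<integral>\<^sup>+ \<tau>. 2 * (ennreal (1 / (1 + \<bar>u\<bar> * \<tau>)\<^sup>2) * indicator {0..1} \<tau>) \<partial>lborel)"
  proof (rule nn_integral_mono)
    fix \<tau> :: real
    show "ennreal (1 / (1 + (u * \<tau>)\<^sup>2)) * indicator {0..1} \<tau>
       \<le> 2 * (ennreal (1 / (1 + \<bar>u\<bar> * \<tau>)\<^sup>2) * indicator {0..1} \<tau>)"
    proof (cases "\<tau> \<in> {0..1}")
      case True
      then have "ennreal (1 / (1 + (u * \<tau>)\<^sup>2)) \<le> ennreal (2 * (1 / (1 + \<bar>u\<bar> * \<tau>)\<^sup>2))"
        by (intro ennreal_leI b) simp
      also have "\<dots> = 2 * ennreal (1 / (1 + \<bar>u\<bar> * \<tau>)\<^sup>2)"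
        by (subst ennreal_mult) auto
      finally show ?thesis using True by simp
    qed simp
  qed
  also have "\<dots> = 2 * ennreal (1 / (1 + \<bar>u\<bar>))"
    by (subst nn_integral_cmult) (simp_all add: 1)
  also have "\<dots> = ennreal (2 / (1 + \<bar>u\<bar>))"
    using ennreal_mult[of 2 "1 / (1 + \<bar>u\<bar>)"] by simp
  finally show "(\<integral>\<^sup>+ \<tau>. ennreal (1 / (1 + (u * \<tau>)\<^sup>2)) * indicator {0..1} \<tau> \<partial>lborel) \<le> ennreal (2 / (1 + \<bar>u\<bar>))" .
qed

section \<open>The function Q as a Lebesgue integral, and its decay\<close>

definition Q_integrand :: "real \<Rightarrow> real \<Rightarrow> real \<Rightarrow> real \<Rightarrow> real" where
  "Q_integrand \<alpha> x y \<tau> = 1 / ((x * \<tau> + 1) powr \<alpha> * (y * \<tau> + 1) powr (1 - \<alpha>))"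

lemma Q_integrand_nonneg: "0 \<le> Q_integrand \<alpha> x y \<tau>"
  by (simp add: Q_integrand_def)

lemma Q_integrand_measurable [measurable]:
  assumes [measurable]: "f \<in> borel_measurable M" "g \<in> borel_measurable M" "h \<in> borel_measurable M"
  shows "(\<lambda>x. Q_integrand \<alpha> (f x) (g x) (h x)) \<in> borel_measurable M"
  unfolding Q_integrand_def by measurable

text \<open>The integrand is continuous on the unit interval, so the gauge integral in
  \<open>Qfun\<close> is a nonnegative Lebesgue integral. In this form Tonelli applies and
  measurability in the parameters is automatic.\<close>

lemma ennreal_Qfun:
  assumes "0 \<le> x" "0 \<le> y"
  shows "ennreal (Qfun \<alpha> x y) = (\<integral>\<^sup>+ \<tau>. ennreal (Q_integrand \<alpha> x y \<tau>) * indicator {0..1} \<tau> \<partial>lborel)"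
proof -
  have nz: "x * \<tau> + 1 \<noteq> 0 \<and> y * \<tau> + 1 \<noteq> 0" if "0 \<le> \<tau>" for \<tau>
  proof -
    have "0 \<le> x * \<tau>" "0 \<le> y * \<tau>" using that assms by auto
    then show ?thesis by linarith
  qed
  have "continuous_on {0..1} (Q_integrand \<alpha> x y)"
    unfolding Q_integrand_def using nz by (intro continuous_intros) auto
  then have "(Q_integrand \<alpha> x y has_integral Qfun \<alpha> x y) {0..1}"
    unfolding Qfun_def Q_integrand_def[symmetric] Q_integrand_def[abs_def, symmetric]
    by (intro integrable_integral integrable_continuous_real)
  then show ?thesis
    by (subst nn_integral_has_integral_lebesgue') (auto simp: Q_integrand_nonneg)
qed

lemma Qfun_commute: "Qfun \<alpha> x y = Qfun (1 - \<alpha>) y x"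
  by (simp add: Qfun_def mult.commute)

text \<open>The factor with x is at least 1 and is dropped. For \<tau> \<le> 1 one has y \<tau> + 1
  \<ge> (1 + y) \<tau>, and the remaining integral of \<open>\<tau> powr (\<alpha> - 1)\<close> is 1
  / \<alpha>.\<close>

lemma Qfun_le:
  assumes \<alpha>: "0 < \<alpha>" "\<alpha> < 1" and xy: "0 \<le> x" "0 \<le> y"
  shows "Qfun \<alpha> x y \<le> 1 / \<alpha> * (1 + y) powr (\<alpha> - 1)"
proof -
  have "ennreal (Qfun \<alpha> x y) \<le> (\<integral>\<^sup>+ \<tau>. ennreal ((1 + y) powr (\<alpha> - 1)) * (ennreal (\<tau> powr (\<alpha> - 1)) * indicator {0..1} \<tau>) \<partial>lborel)"
    unfolding ennreal_Qfun[OF xy]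
  proof (rule nn_integral_mono_AE)
    \<comment> \<open>The pointwise bound fails at \<tau> = 0, where
      \<open>0 powr (\<alpha> - 1)\<close> is 0 by convention while the integrand of Q is 1.\<close>
    have "AE \<tau> in lborel. \<tau> \<noteq> (0::real)" by (rule AE_lborel_singleton)
    then show "AE \<tau> in lborel. ennreal (Q_integrand \<alpha> x y \<tau>) * indicator {0..1} \<tau>
       \<le> ennreal ((1 + y) powr (\<alpha> - 1)) * (ennreal (\<tau> powr (\<alpha> - 1)) * indicator {0..1} \<tau>)"
    proof eventually_elim
      case (elim \<tau>)
      have "Q_integrand \<alpha> x y \<tau> \<le> (1 + y) powr (\<alpha> - 1) * \<tau> powr (\<alpha> - 1)" if \<tau>: "0 < \<tau>" "\<tau> \<le> 1"
      proof -
        have "1 powr \<alpha> \<le> (x * \<tau> + 1) powr \<alpha>"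
          using xy \<tau> \<alpha> by (intro powr_mono2) auto
        then have "1 * (y * \<tau> + 1) powr (1 - \<alpha>) \<le> (x * \<tau> + 1) powr \<alpha> * (y * \<tau> + 1) powr (1 - \<alpha>)"
          by (intro mult_right_mono) auto
        moreover have "0 < y * \<tau> + 1" using xy \<tau> by (intro add_nonneg_pos) auto
        ultimately have "Q_integrand \<alpha> x y \<tau> \<le> 1 / (y * \<tau> + 1) powr (1 - \<alpha>)"
          unfolding Q_integrand_def by (intro frac_le) auto
        also have "\<dots> = (y * \<tau> + 1) powr (\<alpha> - 1)"
          using powr_minus_divide[of "y * \<tau> + 1" "1 - \<alpha>"] by simp
        also have "\<dots> \<le> ((1 + y) * \<tau>) powr (\<alpha> - 1)"
          using xy \<tau> \<alpha> by (intro powr_mono2') (auto simp: algebra_simps add_pos_nonneg)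
        also have "\<dots> = (1 + y) powr (\<alpha> - 1) * \<tau> powr (\<alpha> - 1)"
          using xy \<tau> by (intro powr_mult)
        finally show ?thesis .
      qed
      then show ?case
        using elim by (auto simp: indicator_def ennreal_mult[symmetric] intro: ennreal_leI)
    qed
  qed
  also have "\<dots> = ennreal ((1 + y) powr (\<alpha> - 1)) * ennreal (1 / \<alpha>)"
    using has_integral_powr_from_0[of "\<alpha> - 1" 1] \<alpha>
    by (subst nn_integral_cmult) (auto simp: nn_integral_has_integral_lebesgue')
  also have "\<dots> = ennreal (1 / \<alpha> * (1 + y) powr (\<alpha> - 1))"
    using \<alpha> by (subst ennreal_mult[symmetric]) (auto simp: mult.commute)
  finally show ?thesis
    using \<alpha> by (subst (asm) ennreal_le_iff) auto
qed

lemma Qfun_le':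
  assumes \<alpha>: "0 < \<alpha>" "\<alpha> < 1" and xy: "0 \<le> x" "0 \<le> y"
  shows "Qfun \<alpha> x y \<le> 1 / (1 - \<alpha>) * (1 + x) powr (- \<alpha>)"
  using Qfun_le[of "1 - \<alpha>" y x] assms by (simp add: Qfun_commute[of \<alpha>])

section \<open>Comparison of the imaginary part of the kernel with the integrand of Q\<close>

text \<open>On a subinterval of [0, pi] the sine is smallest at an endpoint: it increases up to pi /
  2 and is symmetric about that point.\<close>

lemma sin_ge_min:
  assumes "0 \<le> \<phi>" "\<phi> \<le> \<theta>" "0 \<le> \<psi>" "\<theta> \<le> pi - \<psi>"
  shows "min (sin \<phi>) (sin \<psi>) \<le> sin \<theta>"
proof (cases "\<theta> \<le> pi / 2")
  case True
  then have "sin \<phi> \<le> sin \<theta>" using assms by (intro sin_monotone_2pi_le) auto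
  then show ?thesis by simp
next
  case False
  then have "sin \<psi> \<le> sin (pi - \<theta>)" using assms by (intro sin_monotone_2pi_le) auto
  then show ?thesis by simp
qed

text \<open>This is \<open>- Im\<close> of the product kernel at \<open>z = \<i> / \<tau>\<close>, rescaled by \<open>1 / \<tau>\<close>
  so that it also makes sense for \<open>\<tau> = 0\<close>.\<close>
definition Im_kernel :: "real \<Rightarrow> real \<Rightarrow> real \<Rightarrow> real \<Rightarrow> real" where
  "Im_kernel \<alpha> s t \<tau> = - Im ((\<i> + of_real (s * \<tau>)) powr (- of_real \<alpha>) * (\<i> + of_real (t * \<tau>)) powr (- of_real (1 - \<alpha>)))"

lemma Im_kernel_measurable [measurable]:
  assumes [measurable]: "f \<in> borel_measurable M" "g \<in> borel_measurable M" "h \<in> borel_measurable M"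
  shows "(\<lambda>x. Im_kernel \<alpha> (f x) (g x) (h x)) \<in> borel_measurable M"
  unfolding Im_kernel_def by measurable

text \<open>The product of the two powers is E exp(-i \<theta>), with modulus E and \<theta> in (0,
  pi) the weighted mean of the two arguments, so the kernel is E sin \<theta>. As |i + x| lies
  between (1 + |x|) / 2 and 1 + |x|, E lies between the integrand of Q and twice that integrand.
  Opposite signs put one argument above and the other below pi / 2, which keeps \<theta> away from 0
  and pi.\<close>

lemma Im_kernel_bounds:
  assumes \<alpha>: "0 < \<alpha>" "\<alpha> < 1" and \<tau>: "0 \<le> \<tau>"
  shows "0 \<le> Im_kernel \<alpha> s t \<tau>"
    and "Im_kernel \<alpha> s t \<tau> \<le> 2 * Q_integrand \<alpha> \<bar>s\<bar> \<bar>t\<bar> \<tau>"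
    and "s \<le> 0 \<and> 0 \<le> t \<or> t \<le> 0 \<and> 0 \<le> s \<Longrightarrow>
      min (sin (\<alpha> * pi / 2)) (sin ((1 - \<alpha>) * pi / 2)) * Q_integrand \<alpha> \<bar>s\<bar> \<bar>t\<bar> \<tau> \<le> Im_kernel \<alpha> s t \<tau>"
proof -
  define A where "A = \<i> + of_real (s * \<tau>)"
  define B where "B = \<i> + of_real (t * \<tau>)"
  have A: "Im A = 1" "A \<noteq> 0" and B: "Im B = 1" "B \<noteq> 0" by (auto simp: A_def B_def complex_eq_iff)
  define \<phi> where "\<phi> = Im (Ln A)"
  define \<psi> where "\<psi> = Im (Ln B)"
  define \<theta> where "\<theta> = \<alpha> * \<phi> + (1 - \<alpha>) * \<psi>"
  have \<phi>: "0 < \<phi>" "\<phi> < pi" and \<psi>: "0 < \<psi>" "\<psi> < pi"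
    using Im_Ln_pos_lt_imp[of A] Im_Ln_pos_lt_imp[of B] A B by (auto simp: \<phi>_def \<psi>_def)
  have \<phi>1: "s \<le> 0 \<Longrightarrow> pi / 2 \<le> \<phi>" and \<phi>2: "0 \<le> s \<Longrightarrow> \<phi> \<le> pi / 2"
    using Re_Ln_pos_lt[OF A(2)] Re_Ln_pos_le[OF A(2)] \<tau> \<phi>
    by (auto simp: A_def \<phi>_def zero_less_mult_iff)
  have \<psi>1: "t \<le> 0 \<Longrightarrow> pi / 2 \<le> \<psi>" and \<psi>2: "0 \<le> t \<Longrightarrow> \<psi> \<le> pi / 2"
    using Re_Ln_pos_lt[OF B(2)] Re_Ln_pos_le[OF B(2)] \<tau> \<psi>
    by (auto simp: B_def \<psi>_def zero_less_mult_iff)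
  have norm_bounds: "1 + \<bar>x\<bar> \<le> 2 * norm (\<i> + of_real x) \<and> norm (\<i> + of_real x) \<le> 1 + \<bar>x\<bar>" for x :: real
    using norm_triangle_ineq[of \<i> "of_real x"] abs_Re_le_cmod[of "\<i> + of_real x"] abs_Im_le_cmod[of "\<i> + of_real x"]
    by auto
  define E where "E = norm A powr - \<alpha> * norm B powr - (1 - \<alpha>)"
  have K: "Im_kernel \<alpha> s t \<tau> = E * sin \<theta>"
  proof -
    define w where "w = - of_real \<alpha> * Ln A - of_real (1 - \<alpha>) * Ln B"
    have "A powr (- of_real \<alpha>) * B powr (- of_real (1 - \<alpha>)) = exp w"
      using A B by (simp add: powr_def w_def exp_add[symmetric] algebra_simps)
    then have "Im_kernel \<alpha> s t \<tau> = - (exp (Re w) * sin (Im w))"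
      by (simp only: Im_kernel_def A_def[symmetric] B_def[symmetric] Im_exp)
    moreover have "Im w = - \<theta>"
      by (simp add: w_def \<theta>_def \<phi>_def \<psi>_def)
    moreover have "exp (Re w) = E"
      using A B by (simp add: w_def E_def powr_def exp_add[symmetric] algebra_simps)
    ultimately show ?thesis by simp
  qed
  have \<theta>: "0 < \<theta>" "\<theta> < pi"
  proof -
    show "0 < \<theta>" using \<alpha> \<phi> \<psi> by (simp add: \<theta>_def add_pos_pos)
    have "\<theta> < \<alpha> * pi + (1 - \<alpha>) * pi"
      unfolding \<theta>_def using \<alpha> \<phi> \<psi> by (intro add_strict_mono mult_strict_left_mono) auto
    then show "\<theta> < pi" by (simp add: algebra_simps)
  qed
  have E: "0 \<le> E" by (simp add: E_def)
  have AB: "1 + \<bar>s\<bar> * \<tau> \<le> 2 * norm A" "norm A \<le> 1 + \<bar>s\<bar> * \<tau>"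
     "1 + \<bar>t\<bar> * \<tau> \<le> 2 * norm B" "norm B \<le> 1 + \<bar>t\<bar> * \<tau>"
    using norm_bounds[of "s * \<tau>"] norm_bounds[of "t * \<tau>"] \<tau> by (auto simp: A_def B_def abs_mult)
  have pos: "0 < 1 + \<bar>s\<bar> * \<tau>" "0 < 1 + \<bar>t\<bar> * \<tau>" using \<tau> by (auto intro: add_pos_nonneg)
  have Q: "Q_integrand \<alpha> \<bar>s\<bar> \<bar>t\<bar> \<tau> = (1 + \<bar>s\<bar> * \<tau>) powr - \<alpha> * (1 + \<bar>t\<bar> * \<tau>) powr - (1 - \<alpha>)"
    by (simp only: Q_integrand_def powr_minus_divide times_divide_times_eq mult_1_left add.commute[of 1])
  have E_ge: "Q_integrand \<alpha> \<bar>s\<bar> \<bar>t\<bar> \<tau> \<le> E"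
    unfolding Q E_def using \<alpha> A B AB by (intro mult_mono powr_mono2') auto
  have "E \<le> ((1 + \<bar>s\<bar> * \<tau>) / 2) powr - \<alpha> * ((1 + \<bar>t\<bar> * \<tau>) / 2) powr - (1 - \<alpha>)"
    unfolding E_def using \<alpha> A B AB pos by (intro mult_mono powr_mono2') auto
  \<comment> \<open>The two factors 2^\<alpha> and 2^(1 - \<alpha>) from the halved bases multiply
    to 2.\<close>
  also have "\<dots> = 2 * Q_integrand \<alpha> \<bar>s\<bar> \<bar>t\<bar> \<tau>"
  proof -
    have half: "(X / 2) powr - a = 2 powr a * X powr - a" if "0 < X" for X a :: real
      using that by (simp add: powr_divide powr_minus field_simps)
    have "2 powr \<alpha> * 2 powr (1 - \<alpha>) = (2::real)" by (simp flip: powr_add)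
    moreover have "2 powr \<alpha> * X * (2 powr (1 - \<alpha>) * Y) = (2 powr \<alpha> * 2 powr (1 - \<alpha>)) * (X * Y)" for X Y :: real
      by (simp only: mult_ac)
    ultimately show ?thesis unfolding Q half[OF pos(1)] half[OF pos(2)] by simp
  qed
  finally have E_le: "E \<le> 2 * Q_integrand \<alpha> \<bar>s\<bar> \<bar>t\<bar> \<tau>" .
  have sin: "0 \<le> sin \<theta>" using \<theta> by (intro sin_ge_zero) auto
  show "0 \<le> Im_kernel \<alpha> s t \<tau>" unfolding K using E sin by simp
  have "E * sin \<theta> \<le> E * 1" using E by (intro mult_left_mono) auto
  then show "Im_kernel \<alpha> s t \<tau> \<le> 2 * Q_integrand \<alpha> \<bar>s\<bar> \<bar>t\<bar> \<tau>" unfolding K using E_le by simp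
  assume st: "s \<le> 0 \<and> 0 \<le> t \<or> t \<le> 0 \<and> 0 \<le> s"
  have "min (sin (\<alpha> * pi / 2)) (sin ((1 - \<alpha>) * pi / 2)) \<le> sin \<theta>"
    using st
  proof
    assume st: "s \<le> 0 \<and> 0 \<le> t"
    show ?thesis
    proof (rule sin_ge_min)
      \<comment> \<open>The lower bound for \<theta> uses only \<phi> \<ge> pi / 2; the upper one
        uses \<phi> \<le> pi and \<psi> \<le> pi / 2. The other sign pattern exchanges the two
        roles.\<close>
      have "\<alpha> * (pi / 2) \<le> \<alpha> * \<phi>" using \<phi>1 st \<alpha> by (intro mult_left_mono) auto
      moreover have "0 \<le> (1 - \<alpha>) * \<psi>" using \<psi> \<alpha> by simp
      ultimately show "\<alpha> * pi / 2 \<le> \<theta>" by (simp add: \<theta>_def)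
      have "\<alpha> * \<phi> \<le> \<alpha> * pi" "(1 - \<alpha>) * \<psi> \<le> (1 - \<alpha>) * (pi / 2)"
        using \<phi> \<psi>2 st \<alpha> by (auto intro!: mult_left_mono)
      then show "\<theta> \<le> pi - (1 - \<alpha>) * pi / 2" by (simp add: \<theta>_def field_simps)
    qed (use \<alpha> in auto)
  next
    assume st: "t \<le> 0 \<and> 0 \<le> s"
    have "min (sin ((1 - \<alpha>) * pi / 2)) (sin (\<alpha> * pi / 2)) \<le> sin \<theta>"
    proof (rule sin_ge_min)
      have "(1 - \<alpha>) * (pi / 2) \<le> (1 - \<alpha>) * \<psi>" using \<psi>1 st \<alpha> by (intro mult_left_mono) auto
      moreover have "0 \<le> \<alpha> * \<phi>" using \<phi> \<alpha> by simp
      ultimately show "(1 - \<alpha>) * pi / 2 \<le> \<theta>" by (simp add: \<theta>_def)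
      have "\<alpha> * \<phi> \<le> \<alpha> * (pi / 2)" "(1 - \<alpha>) * \<psi> \<le> (1 - \<alpha>) * pi"
        using \<psi> \<phi>2 st \<alpha> by (auto intro!: mult_left_mono)
      then show "\<theta> \<le> pi - \<alpha> * pi / 2" by (simp add: \<theta>_def field_simps)
    qed (use \<alpha> in auto)
    then show ?thesis by (simp add: min.commute)
  qed
  then have "min (sin (\<alpha> * pi / 2)) (sin ((1 - \<alpha>) * pi / 2)) * Q_integrand \<alpha> \<bar>s\<bar> \<bar>t\<bar> \<tau> \<le> sin \<theta> * Q_integrand \<alpha> \<bar>s\<bar> \<bar>t\<bar> \<tau>"
    by (intro mult_right_mono Q_integrand_nonneg)
  also have "\<dots> \<le> sin \<theta> * E" using sin E_ge by (intro mult_left_mono)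
  finally show "min (sin (\<alpha> * pi / 2)) (sin ((1 - \<alpha>) * pi / 2)) * Q_integrand \<alpha> \<bar>s\<bar> \<bar>t\<bar> \<tau> \<le> Im_kernel \<alpha> s t \<tau>"
    unfolding K by (simp add: mult.commute)
qed

subsection \<open>Necessity\<close>

lemma (in pair_sigma_finite) integrable_times_fst_snd:
  fixes f :: "'a \<Rightarrow> 'c::{real_normed_algebra, banach, second_countable_topology}"
  assumes f: "integrable M1 f" and g: "integrable M2 g"
  shows "integrable (M1 \<Otimes>\<^sub>M M2) (\<lambda>(x, y). f x * g y)"
    and "(\<integral>p. (\<lambda>(x, y). f x * g y) p \<partial>(M1 \<Otimes>\<^sub>M M2)) = (\<integral>x. f x \<partial>M1) * (\<integral>y. g y \<partial>M2)"
proof -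
  have [measurable]: "f \<in> borel_measurable M1" "g \<in> borel_measurable M2"
    using f g by auto
  have "integrable (M1 \<Otimes>\<^sub>M M2) (\<lambda>(x, y). norm (f x) * norm (g y))"
  proof (rule Fubini_integrable)
    show "integrable M1 (\<lambda>x. \<integral>y. norm (case (x, y) of (x, y) \<Rightarrow> norm (f x) * norm (g y)) \<partial>M2)"
      using f by simp
  qed (use g in auto)
  then show *: "integrable (M1 \<Otimes>\<^sub>M M2) (\<lambda>(x, y). f x * g y)"
    by (rule Bochner_Integration.integrable_bound) (auto simp: norm_mult_ineq)
  show "(\<integral>p. (\<lambda>(x, y). f x * g y) p \<partial>(M1 \<Otimes>\<^sub>M M2)) = (\<integral>x. f x \<partial>M1) * (\<integral>y. g y \<partial>M2)"
    by (subst integral_fst'[symmetric, OF *]) (simp add: f g)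
qed

definition product_kernel :: "real \<Rightarrow> complex \<Rightarrow> real \<Rightarrow> real \<Rightarrow> complex" where
  "product_kernel \<alpha> z s t = (z + of_real s) powr (- of_real \<alpha>) * (z + of_real t) powr (- of_real (1 - \<alpha>))"

text \<open>The kernel is a product of functions of one variable, each integrable by its weight
  condition, so Fubini applies. The product measure has \<open>\<mu>2\<close> first, as in the
  iterated integrals of the theorem; hence \<open>s\<close> is \<open>snd p\<close> and
  \<open>t\<close> is \<open>fst p\<close>.\<close>

lemma product_kernel_integral:
  assumes \<alpha>: "0 < \<alpha>" "\<alpha> < 1" and \<mu>: "\<mu>1 \<in> Mplus \<alpha>" "\<mu>2 \<in> Mplus (1 - \<alpha>)" and z: "0 < Im z"
  shows "integrable (\<mu>2 \<Otimes>\<^sub>M \<mu>1) (\<lambda>p. product_kernel \<alpha> z (snd p) (fst p))"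
    and "(\<integral>p. product_kernel \<alpha> z (snd p) (fst p) \<partial>(\<mu>2 \<Otimes>\<^sub>M \<mu>1)) = Ctrans \<alpha> \<mu>1 z * Ctrans (1 - \<alpha>) \<mu>2 z"
proof -
  interpret pair_sigma_finite \<mu>2 \<mu>1
    using \<mu>[THEN Mplus_sigma_finite] by (simp add: pair_sigma_finite_def)
  have eq: "(\<lambda>p. product_kernel \<alpha> z (snd p) (fst p)) =
     (\<lambda>(t, s). (z + of_real t) powr (- of_real (1 - \<alpha>)) * (z + of_real s) powr (- of_real \<alpha>))"
    by (auto simp: product_kernel_def fun_eq_iff)
  have int: "integrable \<mu>2 (\<lambda>t. (z + of_real t) powr (- of_real (1 - \<alpha>)))"
    "integrable \<mu>1 (\<lambda>s. (z + of_real s) powr (- of_real \<alpha>))"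
    using \<alpha> \<mu> z by (auto intro!: Mplus_integrable_powr simp del: of_real_diff)
  show "integrable (\<mu>2 \<Otimes>\<^sub>M \<mu>1) (\<lambda>p. product_kernel \<alpha> z (snd p) (fst p))"
    unfolding eq by (rule integrable_times_fst_snd(1)[OF int])
  show "(\<integral>p. product_kernel \<alpha> z (snd p) (fst p) \<partial>(\<mu>2 \<Otimes>\<^sub>M \<mu>1)) = Ctrans \<alpha> \<mu>1 z * Ctrans (1 - \<alpha>) \<mu>2 z"
    unfolding eq integrable_times_fst_snd(2)[OF int] Ctrans_def by (simp add: mult.commute)
qed

text \<open>At z = i / \<tau> each base is 1 / \<tau> times i + s \<tau> or i + t \<tau>. A positive
  factor leaves the principal power without a branch correction, and the exponents \<alpha> and 1 -
  \<alpha> add up to 1, so the total factor is \<tau>.\<close>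

lemma Im_product_kernel:
  assumes \<tau>: "0 < \<tau>"
  shows "- Im (product_kernel \<alpha> (\<i> / of_real \<tau>) s t) = \<tau> * Im_kernel \<alpha> s t \<tau>"
proof -
  have scale: "(\<i> / of_real \<tau> + of_real s) powr c = of_real (1 / \<tau>) powr c * (\<i> + of_real (s * \<tau>)) powr c" for s c
  proof -
    have nz: "\<i> + of_real (s * \<tau>) \<noteq> 0" by (auto simp: complex_eq_iff)
    have eq: "\<i> / of_real \<tau> + of_real s = of_real (1 / \<tau>) * (\<i> + of_real (s * \<tau>))"
      using \<tau> by (simp add: field_simps)
    have "(of_real r * y) powr c = of_real r powr c * y powr c" if "0 < r" "y \<noteq> 0" for r and y c :: complex
      using that by (simp add: powr_def Ln_times_of_real Ln_of_real distrib_left exp_add)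
    then show ?thesis
      unfolding eq using \<tau> nz by (simp del: of_real_mult of_real_divide)
  qed
  have "of_real (1 / \<tau>) powr (- of_real \<alpha>) * of_real (1 / \<tau>) powr (- of_real (1 - \<alpha>)) = complex_of_real \<tau>"
    using \<tau> by (subst powr_add[symmetric]) (simp add: powr_minus)
  moreover have "a * x * (b * y) = a * b * (x * y)" for a b x y :: complex
    by (simp only: mult_ac)
  ultimately have "product_kernel \<alpha> (\<i> / of_real \<tau>) s t = of_real \<tau> *
     ((\<i> + of_real (s * \<tau>)) powr (- of_real \<alpha>) * (\<i> + of_real (t * \<tau>)) powr (- of_real (1 - \<alpha>)))"
    unfolding product_kernel_def scale by simp
  moreover have "- Im (of_real \<tau> * w) = \<tau> * - Im w" for w
    by simp
  ultimately show ?thesis unfolding Im_kernel_def by metis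
qed

lemma Im_inverse_i_add: "- Im (1 / (\<i> + of_real x)) = 1 / (1 + x\<^sup>2)"
  by (simp add: Im_divide power2_eq_square)

text \<open>Taking -Im of the product formula at z = i / \<tau> and dividing by \<tau> gives the
  identity \<open>slice\<close>. Integrated over \<tau> in the unit interval, its right side is at
  most twice the integral of 1 / (1 + |u|), hence finite, while its left side dominates a positive
  multiple of Q wherever s and t have opposite signs.\<close>

lemma product_formula_imp_Q_finite:
  assumes \<alpha>: "0 < \<alpha>" "\<alpha> < 1" and \<mu>12: "\<mu>1 \<in> Mplus \<alpha>" "\<mu>2 \<in> Mplus (1 - \<alpha>)" and \<mu>: "\<mu> \<in> Mplus 1"
    and eq: "\<And>z. 0 < Im z \<Longrightarrow> Ctrans \<alpha> \<mu>1 z * Ctrans (1 - \<alpha>) \<mu>2 z = Ctrans 1 \<mu> z"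
  shows "(\<integral>\<^sup>+ t. \<integral>\<^sup>+ s. indicator {p. snd p \<le> 0 \<and> 0 \<le> fst p \<or> fst p \<le> 0 \<and> 0 \<le> snd p} (t, s)
           * ennreal (Qfun \<alpha> \<bar>s\<bar> \<bar>t\<bar>) \<partial>\<mu>1 \<partial>\<mu>2) < \<infinity>"
proof -
  interpret pair_sigma_finite \<mu>2 \<mu>1
    using \<mu>12[THEN Mplus_sigma_finite] by (simp add: pair_sigma_finite_def)
  interpret Pl: pair_sigma_finite "\<mu>2 \<Otimes>\<^sub>M \<mu>1" lborel ..
  interpret M: sigma_finite_measure \<mu> using \<mu> by (rule Mplus_sigma_finite)
  interpret Ml: pair_sigma_finite \<mu> lborel ..
  have [measurable_cong]: "sets \<mu>1 = sets borel" "sets \<mu>2 = sets borel" "sets \<mu> = sets borel"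
    and fin: "(\<integral>\<^sup>+ u. ennreal ((1 + \<bar>u\<bar>) powr - 1) \<partial>\<mu>) < \<infinity>"
    using \<mu>12 \<mu> by (auto simp: Mplus_def)
  have slice: "(\<integral>\<^sup>+ p. ennreal (Im_kernel \<alpha> (snd p) (fst p) \<tau>) \<partial>(\<mu>2 \<Otimes>\<^sub>M \<mu>1))
      = (\<integral>\<^sup>+ u. ennreal (1 / (1 + (u * \<tau>)\<^sup>2)) \<partial>\<mu>)" if \<tau>: "0 < \<tau>" for \<tau>
  proof -
    define z where "z = \<i> / of_real \<tau>"
    have z: "0 < Im z" using \<tau> by (simp add: z_def)
    have I: "Im_kernel \<alpha> s t \<tau> = - Im (product_kernel \<alpha> z s t) / \<tau>" for s t
      using Im_product_kernel[OF \<tau>] \<tau> by (simp add: z_def)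
    have J: "1 / (1 + (u * \<tau>)\<^sup>2) = - Im ((z + of_real u) powr (- of_real 1)) / \<tau>" for u
    proof -
      have "z + of_real u = (\<i> + of_real (u * \<tau>)) / of_real \<tau>"
        using \<tau> by (simp add: z_def field_simps)
      then have "(z + of_real u) powr (- of_real 1) = of_real \<tau> * (1 / (\<i> + of_real (u * \<tau>)))"
        by (simp add: powr_minus divide_inverse)
      then have "- Im ((z + of_real u) powr (- of_real 1)) = \<tau> * - Im (1 / (\<i> + of_real (u * \<tau>)))"
        by (simp only: Im_complex_of_real Re_complex_of_real times_complex.sel mult_zero_left add_0_right mult_minus_right)
      then show ?thesis unfolding Im_inverse_i_add using \<tau> by simp
    qed
    note int = product_kernel_integral[OF \<alpha> \<mu>12 z]
    have intC: "integrable \<mu> (\<lambda>u. (z + of_real u) powr (- of_real 1))"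
      using \<mu> z by (intro Mplus_integrable_powr) auto
    have "(\<integral>\<^sup>+ p. ennreal (Im_kernel \<alpha> (snd p) (fst p) \<tau>) \<partial>(\<mu>2 \<Otimes>\<^sub>M \<mu>1))
       = ennreal (\<integral>p. - Im (product_kernel \<alpha> z (snd p) (fst p)) / \<tau> \<partial>(\<mu>2 \<Otimes>\<^sub>M \<mu>1))"
      unfolding I[symmetric]
    proof (rule nn_integral_eq_integral)
      show "integrable (\<mu>2 \<Otimes>\<^sub>M \<mu>1) (\<lambda>p. Im_kernel \<alpha> (snd p) (fst p) \<tau>)"
        unfolding I using int(1) by simp
    qed (use Im_kernel_bounds(1)[OF \<alpha>] \<tau> in auto)
    also have "(\<integral>p. - Im (product_kernel \<alpha> z (snd p) (fst p)) / \<tau> \<partial>(\<mu>2 \<Otimes>\<^sub>M \<mu>1)) = - Im (Ctrans \<alpha> \<mu>1 z * Ctrans (1 - \<alpha>) \<mu>2 z) / \<tau>"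
      unfolding int(2)[symmetric] using int(1) by (simp del: times_complex.sel)
    also have "\<dots> = - Im (Ctrans 1 \<mu> z) / \<tau>" using eq[OF z] by (simp del: times_complex.sel)
    also have "\<dots> = (\<integral>u. 1 / (1 + (u * \<tau>)\<^sup>2) \<partial>\<mu>)"
      unfolding J Ctrans_def using intC by simp
    also have "ennreal \<dots> = (\<integral>\<^sup>+ u. ennreal (1 / (1 + (u * \<tau>)\<^sup>2)) \<partial>\<mu>)"
    proof (rule nn_integral_eq_integral[symmetric])
      show "integrable \<mu> (\<lambda>u. 1 / (1 + (u * \<tau>)\<^sup>2))" unfolding J using intC by auto
    qed auto
    finally show ?thesis .
  qed
  define m where "m = min (sin (\<alpha> * pi / 2)) (sin ((1 - \<alpha>) * pi / 2))"
  \<comment> \<open>Both angles lie strictly between 0 and pi, so the smaller of their sines is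
    positive.\<close>
  have "\<alpha> * (pi / 2) < 1 * pi" "(1 - \<alpha>) * (pi / 2) < 1 * pi"
    using \<alpha> by (auto intro!: mult_strict_mono)
  then have m: "0 < m"
    using \<alpha> unfolding m_def min_less_iff_conj by (auto intro!: sin_gt_zero)
  define L where "L p = (\<integral>\<^sup>+ \<tau>. ennreal (Im_kernel \<alpha> (snd p) (fst p) \<tau>) * indicator {0..1} \<tau> \<partial>lborel)" for p
  have L [measurable]: "L \<in> borel_measurable (\<mu>2 \<Otimes>\<^sub>M \<mu>1)" unfolding L_def by measurable
  have "(\<integral>\<^sup>+ p. L p \<partial>(\<mu>2 \<Otimes>\<^sub>M \<mu>1))
     = (\<integral>\<^sup>+ \<tau>. \<integral>\<^sup>+ p. ennreal (Im_kernel \<alpha> (snd p) (fst p) \<tau>) * indicator {0..1} \<tau> \<partial>(\<mu>2 \<Otimes>\<^sub>M \<mu>1) \<partial>lborel)"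
    unfolding L_def by (rule Pl.Fubini'[symmetric]) measurable
  also have "\<dots> = (\<integral>\<^sup>+ \<tau>. \<integral>\<^sup>+ u. ennreal (1 / (1 + (u * \<tau>)\<^sup>2)) * indicator {0..1} \<tau> \<partial>\<mu> \<partial>lborel)"
  proof (rule nn_integral_cong_AE)
    \<comment> \<open>The identity \<open>slice\<close> concerns z = i / \<tau> and so excludes the
      null set \<tau> = 0.\<close>
    have "AE \<tau> in lborel. \<tau> \<noteq> (0::real)" by (rule AE_lborel_singleton)
    then show "AE \<tau> in lborel. (\<integral>\<^sup>+ p. ennreal (Im_kernel \<alpha> (snd p) (fst p) \<tau>) * indicator {0..1} \<tau> \<partial>(\<mu>2 \<Otimes>\<^sub>M \<mu>1))
       = (\<integral>\<^sup>+ u. ennreal (1 / (1 + (u * \<tau>)\<^sup>2)) * indicator {0..1} \<tau> \<partial>\<mu>)"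
      by eventually_elim (auto simp: indicator_def slice)
  qed
  also have "\<dots> = (\<integral>\<^sup>+ u. \<integral>\<^sup>+ \<tau>. ennreal (1 / (1 + (u * \<tau>)\<^sup>2)) * indicator {0..1} \<tau> \<partial>lborel \<partial>\<mu>)"
    by (rule Ml.Fubini') measurable
  also have "\<dots> \<le> (\<integral>\<^sup>+ u. 2 * ennreal ((1 + \<bar>u\<bar>) powr - 1) \<partial>\<mu>)"
  proof (rule nn_integral_mono)
    fix u :: real
    have "ennreal (2 / (1 + \<bar>u\<bar>)) = 2 * ennreal ((1 + \<bar>u\<bar>) powr - 1)"
      using ennreal_mult[of 2 "1 / (1 + \<bar>u\<bar>)"] by (simp add: powr_minus divide_inverse)
    then show "(\<integral>\<^sup>+ \<tau>. ennreal (1 / (1 + (u * \<tau>)\<^sup>2)) * indicator {0..1} \<tau> \<partial>lborel) \<le> 2 * ennreal ((1 + \<bar>u\<bar>) powr - 1)"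
      using nn_integral_inverse_quadratic(2)[of u] by simp
  qed
  also have "\<dots> < \<infinity>" using fin by (subst nn_integral_cmult) (auto simp: ennreal_mult_less_top)
  finally have Lfin: "(\<integral>\<^sup>+ p. L p \<partial>(\<mu>2 \<Otimes>\<^sub>M \<mu>1)) < \<infinity>" .
  have le: "indicator {p. snd p \<le> 0 \<and> 0 \<le> fst p \<or> fst p \<le> 0 \<and> 0 \<le> snd p} (t, s) * ennreal (Qfun \<alpha> \<bar>s\<bar> \<bar>t\<bar>)
      \<le> ennreal (1 / m) * L (t, s)" for t s
  proof (cases "s \<le> 0 \<and> 0 \<le> t \<or> t \<le> 0 \<and> 0 \<le> s")
    case True
    have "ennreal (Qfun \<alpha> \<bar>s\<bar> \<bar>t\<bar>) \<le> (\<integral>\<^sup>+ \<tau>. ennreal (1 / m) * (ennreal (Im_kernel \<alpha> s t \<tau>) * indicator {0..1} \<tau>) \<partial>lborel)"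
    proof (subst ennreal_Qfun, simp, simp, rule nn_integral_mono)
      fix \<tau> :: real
      have "Q_integrand \<alpha> \<bar>s\<bar> \<bar>t\<bar> \<tau> \<le> 1 / m * Im_kernel \<alpha> s t \<tau>" if "0 \<le> \<tau>"
        using Im_kernel_bounds(3)[OF \<alpha> that True] m unfolding m_def[symmetric] by (simp add: field_simps)
      then show "ennreal (Q_integrand \<alpha> \<bar>s\<bar> \<bar>t\<bar> \<tau>) * indicator {0..1} \<tau>
         \<le> ennreal (1 / m) * (ennreal (Im_kernel \<alpha> s t \<tau>) * indicator {0..1} \<tau>)"
        using m Im_kernel_bounds(1)[OF \<alpha>, of \<tau> s t]
        by (auto simp: indicator_def ennreal_mult[symmetric] intro: ennreal_leI)
    qed
    also have "\<dots> = ennreal (1 / m) * L (t, s)"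
      unfolding L_def by (subst nn_integral_cmult) auto
    finally show ?thesis using True by simp
  qed simp
  have "(\<integral>\<^sup>+ t. \<integral>\<^sup>+ s. indicator {p. snd p \<le> 0 \<and> 0 \<le> fst p \<or> fst p \<le> 0 \<and> 0 \<le> snd p} (t, s)
           * ennreal (Qfun \<alpha> \<bar>s\<bar> \<bar>t\<bar>) \<partial>\<mu>1 \<partial>\<mu>2) \<le> (\<integral>\<^sup>+ t. \<integral>\<^sup>+ s. ennreal (1 / m) * L (t, s) \<partial>\<mu>1 \<partial>\<mu>2)"
    by (intro nn_integral_mono le)
  also have "\<dots> = (\<integral>\<^sup>+ p. ennreal (1 / m) * L p \<partial>(\<mu>2 \<Otimes>\<^sub>M \<mu>1))"
    by (rule M2.nn_integral_fst) measurable
  also have "\<dots> < \<infinity>" using Lfin by (subst nn_integral_cmult) (auto simp: ennreal_mult_less_top)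
  finally show ?thesis .
qed

subsection \<open>Sufficiency\<close>

definition weighted_mean :: "real \<Rightarrow> real \<Rightarrow> real \<Rightarrow> real" where
  "weighted_mean s t w = (s * w + t) / (w + 1)"

lemma weighted_mean_measurable [measurable]:
  assumes [measurable]: "f \<in> borel_measurable M" "g \<in> borel_measurable M" "h \<in> borel_measurable M"
  shows "(\<lambda>x. weighted_mean (f x) (g x) (h x)) \<in> borel_measurable M"
  unfolding weighted_mean_def by measurable

text \<open>Clearing the denominator w + 1 produces the form w A + B of Feynman's formula. The scale
  c serves two purposes: c = 1 yields the product formula, and z = i with c = \<tau> yields the
  kernel on the imaginary axis.\<close>

lemma inverse_add_weighted_mean:
  fixes z :: complex
  assumes "0 < w"
  shows "1 / (z + of_real (c * weighted_mean s t w))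
    = of_real (w + 1) / (of_real w * (z + of_real (s * c)) + (z + of_real (t * c)))"
proof -
  have nz: "complex_of_real (w + 1) \<noteq> 0" using assms by (simp only: of_real_eq_0_iff)
  have "c * weighted_mean s t w * (w + 1) = c * (s * w + t)"
    using assms by (simp add: weighted_mean_def)
  then have "of_real (c * weighted_mean s t w) * of_real (w + 1) = complex_of_real (c * (s * w + t))"
    by (metis of_real_mult)
  then have *: "of_real w * (z + of_real (s * c)) + (z + of_real (t * c)) = of_real (w + 1) * (z + of_real (c * weighted_mean s t w))"
    by (simp add: algebra_simps)
  have "W / (W * D) = 1 / D" if "W \<noteq> 0" for W D :: complex
    using that by simp
  then show ?thesis unfolding * using nz by metis
qed

section \<open>Integrals of weighted means against the beta measure\<close>

locale beta_measure =
  fixes \<rho> :: "real measure" and \<alpha> :: real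
  assumes sets_rho [measurable_cong]: "sets \<rho> = sets borel"
    and prob_rho: "emeasure \<rho> (space \<rho>) = 1"
    and pos_rho: "AE w in \<rho>. 0 < w"
    and scale_rho: "0 < p \<Longrightarrow> (\<integral>\<^sup>+ w. ennreal ((w + 1) / (w + p)) \<partial>\<rho>) = ennreal (p powr (\<alpha> - 1))"
    and alpha: "0 < \<alpha>" "\<alpha> < 1"
begin

sublocale finite_measure \<rho>
  by (rule finite_measureI) (simp add: prob_rho)

lemma Feynman:
  assumes z: "0 < Im z"
  shows "integrable \<rho> (\<lambda>w. 1 / (z + of_real (c * weighted_mean s t w)))"
    and "(\<integral>w. 1 / (z + of_real (c * weighted_mean s t w)) \<partial>\<rho>) = product_kernel \<alpha> z (s * c) (t * c)"
proof -
  define A where "A = z + of_real (s * c)"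
  define B where "B = z + of_real (t * c)"
  have AB: "0 < Im A" "0 < Im B" using z by (auto simp: A_def B_def)
  have fin: "emeasure \<rho> (space \<rho>) \<noteq> \<infinity>" by (simp add: prob_rho)
  note F = beta_measure_Feynman[OF sets_rho fin pos_rho scale_rho AB]
  have AE: "AE w in \<rho>. of_real (w + 1) / (of_real w * A + B) = 1 / (z + of_real (c * weighted_mean s t w))"
    using pos_rho by eventually_elim (simp only: inverse_add_weighted_mean A_def B_def)
  show "integrable \<rho> (\<lambda>w. 1 / (z + of_real (c * weighted_mean s t w)))"
    by (rule integrable_cong_AE_imp[OF F(1) _ AE]) measurable
  have "(\<integral>w. 1 / (z + of_real (c * weighted_mean s t w)) \<partial>\<rho>) = (\<integral>w. of_real (w + 1) / (of_real w * A + B) \<partial>\<rho>)"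
    using AE by (intro integral_cong_AE) (auto elim: eventually_mono)
  then show "(\<integral>w. 1 / (z + of_real (c * weighted_mean s t w)) \<partial>\<rho>) = product_kernel \<alpha> z (s * c) (t * c)"
    using F(2) by (simp only: product_kernel_def A_def B_def)
qed

text \<open>Replace 1 / (1 + |u|) by the larger integral of 1 / (1 + (u \<tau>)^2) over the unit
  interval and exchange the integrals. By Feynman's formula at z = i the inner integral is
  \<open>Im_kernel\<close>, which is at most twice the integrand of Q for any signs of s and
  t.\<close>

lemma nn_integral_weighted_mean_le_Qfun:
  "(\<integral>\<^sup>+ w. ennreal (1 / (1 + \<bar>weighted_mean s t w\<bar>)) \<partial>\<rho>) \<le> 2 * ennreal (Qfun \<alpha> \<bar>s\<bar> \<bar>t\<bar>)"
proof -
  interpret Pl: pair_sigma_finite \<rho> lborel ..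
  let ?U = "weighted_mean s t"
  have slice: "(\<integral>\<^sup>+ w. ennreal (1 / (1 + (?U w * \<tau>)\<^sup>2)) \<partial>\<rho>) = ennreal (Im_kernel \<alpha> s t \<tau>)" for \<tau>
  proof -
    have eq: "1 / (1 + (?U w * \<tau>)\<^sup>2) = - Im (1 / (\<i> + of_real (\<tau> * ?U w)))" for w
      by (simp only: Im_inverse_i_add mult.commute)
    have "integrable \<rho> (\<lambda>w. 1 / (1 + (?U w * \<tau>)\<^sup>2))"
      unfolding eq by (intro integrable_minus integrable_Im Feynman) simp
    then have "(\<integral>\<^sup>+ w. ennreal (1 / (1 + (?U w * \<tau>)\<^sup>2)) \<partial>\<rho>) = ennreal (\<integral>w. 1 / (1 + (?U w * \<tau>)\<^sup>2) \<partial>\<rho>)"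
      by (rule nn_integral_eq_integral) auto
    also have "(\<integral>w. 1 / (1 + (?U w * \<tau>)\<^sup>2) \<partial>\<rho>) = - Im (\<integral>w. 1 / (\<i> + of_real (\<tau> * ?U w)) \<partial>\<rho>)"
      unfolding eq using Feynman(1)[of \<i> \<tau> s t] by (simp only: integral_minus integral_Im) simp
    also have "\<dots> = Im_kernel \<alpha> s t \<tau>"
      by (subst Feynman(2)) (simp_all only: Im_kernel_def product_kernel_def imaginary_unit.sel zero_less_one)
    finally show ?thesis .
  qed
  have "(\<integral>\<^sup>+ w. ennreal (1 / (1 + \<bar>?U w\<bar>)) \<partial>\<rho>)
      \<le> (\<integral>\<^sup>+ w. \<integral>\<^sup>+ \<tau>. ennreal (1 / (1 + (?U w * \<tau>)\<^sup>2)) * indicator {0..1} \<tau> \<partial>lborel \<partial>\<rho>)"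
    by (intro nn_integral_mono nn_integral_inverse_quadratic)
  also have "\<dots> = (\<integral>\<^sup>+ \<tau>. \<integral>\<^sup>+ w. ennreal (1 / (1 + (?U w * \<tau>)\<^sup>2)) * indicator {0..1} \<tau> \<partial>\<rho> \<partial>lborel)"
    by (rule Pl.Fubini'[symmetric]) measurable
  also have "\<dots> = (\<integral>\<^sup>+ \<tau>. ennreal (Im_kernel \<alpha> s t \<tau>) * indicator {0..1} \<tau> \<partial>lborel)"
    by (intro nn_integral_cong) (simp add: slice nn_integral_multc)
  also have "\<dots> \<le> (\<integral>\<^sup>+ \<tau>. 2 * (ennreal (Q_integrand \<alpha> \<bar>s\<bar> \<bar>t\<bar> \<tau>) * indicator {0..1} \<tau>) \<partial>lborel)"
  proof (rule nn_integral_mono)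
    fix \<tau> :: real
    show "ennreal (Im_kernel \<alpha> s t \<tau>) * indicator {0..1} \<tau>
      \<le> 2 * (ennreal (Q_integrand \<alpha> \<bar>s\<bar> \<bar>t\<bar> \<tau>) * indicator {0..1} \<tau>)"
    proof (cases "\<tau> \<in> {0..1}")
      case True
      then have "ennreal (Im_kernel \<alpha> s t \<tau>) \<le> ennreal (2 * Q_integrand \<alpha> \<bar>s\<bar> \<bar>t\<bar> \<tau>)"
        using Im_kernel_bounds(2)[OF alpha, of \<tau> s t] by (intro ennreal_leI) simp
      also have "\<dots> = 2 * ennreal (Q_integrand \<alpha> \<bar>s\<bar> \<bar>t\<bar> \<tau>)"
        by (subst ennreal_mult) (auto simp: Q_integrand_nonneg)
      finally show ?thesis using True by simp
    qed simp
  qed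
  also have "\<dots> = 2 * ennreal (Qfun \<alpha> \<bar>s\<bar> \<bar>t\<bar>)"
    by (subst nn_integral_cmult) (auto simp: ennreal_Qfun)
  finally show ?thesis .
qed

text \<open>Without cancellation in s w + t, the sum 1 + |u| equals (1 + |s|) (w + p) / (w + 1) with
  p = (1 + |t|) / (1 + |s|). Its reciprocal is a multiple of the function whose integral is
  prescribed by \<open>scale_rho\<close>.\<close>

lemma nn_integral_weighted_mean_same_sign:
  assumes st: "0 \<le> s \<and> 0 \<le> t \<or> s \<le> 0 \<and> t \<le> 0"
  shows "(\<integral>\<^sup>+ w. ennreal (1 / (1 + \<bar>weighted_mean s t w\<bar>)) \<partial>\<rho>)
    = ennreal ((1 + \<bar>s\<bar>) powr - \<alpha> * (1 + \<bar>t\<bar>) powr - (1 - \<alpha>))"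
proof -
  define p where "p = (1 + \<bar>t\<bar>) / (1 + \<bar>s\<bar>)"
  have p: "0 < p" by (simp add: p_def add_pos_nonneg)
  have "(\<integral>\<^sup>+ w. ennreal (1 / (1 + \<bar>weighted_mean s t w\<bar>)) \<partial>\<rho>)
     = (\<integral>\<^sup>+ w. ennreal (1 / (1 + \<bar>s\<bar>)) * ennreal ((w + 1) / (w + p)) \<partial>\<rho>)"
  proof (rule nn_integral_cong_AE)
    show "AE w in \<rho>. ennreal (1 / (1 + \<bar>weighted_mean s t w\<bar>)) = ennreal (1 / (1 + \<bar>s\<bar>)) * ennreal ((w + 1) / (w + p))"
      using pos_rho
    proof eventually_elim
      case (elim w)
      have "\<bar>s * w + t\<bar> = \<bar>s\<bar> * w + \<bar>t\<bar>"
        using st elim by (auto simp: abs_of_nonneg abs_of_nonpos add_nonpos_nonpos mult_nonpos_nonneg)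
      then have "\<bar>weighted_mean s t w\<bar> = (\<bar>s\<bar> * w + \<bar>t\<bar>) / (w + 1)"
        using elim by (simp add: weighted_mean_def)
      moreover have "(1 + \<bar>s\<bar>) * (w + p) = (1 + \<bar>s\<bar>) * w + (1 + \<bar>t\<bar>)"
      proof -
        have "1 + \<bar>s\<bar> \<noteq> 0" by linarith
        then have "(1 + \<bar>s\<bar>) * p = 1 + \<bar>t\<bar>" unfolding p_def times_divide_eq_right by (rule nonzero_mult_div_cancel_left)
        then show ?thesis by (simp only: distrib_left)
      qed
      ultimately have "1 + \<bar>weighted_mean s t w\<bar> = (1 + \<bar>s\<bar>) * (w + p) / (w + 1)"
        using elim by (simp add: divide_simps) (simp add: algebra_simps)
      then have "1 / (1 + \<bar>weighted_mean s t w\<bar>) = 1 / (1 + \<bar>s\<bar>) * ((w + 1) / (w + p))"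
        by simp
      then show ?case using elim p by (simp add: ennreal_mult[symmetric])
    qed
  qed
  also have "\<dots> = ennreal (1 / (1 + \<bar>s\<bar>)) * ennreal (p powr (\<alpha> - 1))"
    by (subst nn_integral_cmult) (auto simp: scale_rho p)
  also have "\<dots> = ennreal ((1 + \<bar>s\<bar>) powr - \<alpha> * (1 + \<bar>t\<bar>) powr - (1 - \<alpha>))"
  proof -
    have "(1 + \<bar>s\<bar>) powr (\<alpha> - 1) = (1 + \<bar>s\<bar>) powr \<alpha> / (1 + \<bar>s\<bar>)"
      by (simp add: powr_diff)
    then have "1 / (1 + \<bar>s\<bar>) * p powr (\<alpha> - 1) = (1 + \<bar>s\<bar>) powr - \<alpha> * (1 + \<bar>t\<bar>) powr - (1 - \<alpha>)"
      by (simp add: p_def powr_divide powr_minus_divide)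
    then show ?thesis by (simp add: ennreal_mult[symmetric])
  qed
  finally show ?thesis .
qed

end

text \<open>The image of the triple product measure under the weighted mean satisfies the formula by
  Fubini and Feynman, once it is known to integrate 1 / (1 + |u|). That follows from a bound for the
  inner integral \<open>G s t\<close>: by \<open>r s t\<close> for equal signs, by a multiple of
  \<open>r s t\<close> when s or t is small, and by 2 Q on the two far quadrants of opposite
  signs.\<close>

lemma Q_finite_imp_product_formula:
  assumes \<alpha>: "0 < \<alpha>" "\<alpha> < 1" and \<mu>12: "\<mu>1 \<in> Mplus \<alpha>" "\<mu>2 \<in> Mplus (1 - \<alpha>)" and a: "0 \<le> a"
    and Q1: "(\<integral>\<^sup>+ t. \<integral>\<^sup>+ s. indicator {a..} t * (indicator {..-a} s * ennreal (Qfun \<alpha> \<bar>s\<bar> \<bar>t\<bar>)) \<partial>\<mu>1 \<partial>\<mu>2) < \<infinity>"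
    and Q2: "(\<integral>\<^sup>+ t. \<integral>\<^sup>+ s. indicator {..-a} t * (indicator {a..} s * ennreal (Qfun \<alpha> \<bar>s\<bar> \<bar>t\<bar>)) \<partial>\<mu>1 \<partial>\<mu>2) < \<infinity>"
  shows "\<exists>\<mu> \<in> Mplus 1. \<forall>z. Im z > 0 \<longrightarrow> Ctrans \<alpha> \<mu>1 z * Ctrans (1 - \<alpha>) \<mu>2 z = Ctrans 1 \<mu> z"
proof -
  obtain \<rho> where "sets \<rho> = sets borel" "emeasure \<rho> (space \<rho>) = 1" "AE w in \<rho>. 0 < w"
    "\<And>p. 0 < p \<Longrightarrow> (\<integral>\<^sup>+ w. ennreal ((w + 1) / (w + p)) \<partial>\<rho>) = ennreal (p powr (\<alpha> - 1))"
    using beta_measure_exists[OF \<alpha>] by blast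
  then interpret R: beta_measure \<rho> \<alpha> by unfold_locales (use \<alpha> in auto)
  note [measurable_cong] = R.sets_rho
  interpret pair_sigma_finite \<mu>2 \<mu>1
    using \<mu>12[THEN Mplus_sigma_finite] by (simp add: pair_sigma_finite_def)
  interpret T: pair_sigma_finite "\<mu>2 \<Otimes>\<^sub>M \<mu>1" \<rho> ..
  have [measurable_cong]: "sets \<mu>1 = sets borel" "sets \<mu>2 = sets borel"
    and fin1: "(\<integral>\<^sup>+ s. ennreal ((1 + \<bar>s\<bar>) powr - \<alpha>) \<partial>\<mu>1) < \<infinity>"
    and fin2: "(\<integral>\<^sup>+ t. ennreal ((1 + \<bar>t\<bar>) powr - (1 - \<alpha>)) \<partial>\<mu>2) < \<infinity>"
    using \<mu>12 by (auto simp: Mplus_def)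
  define U where "U q = weighted_mean (snd (fst q)) (fst (fst q)) (snd q)" for q :: "(real \<times> real) \<times> real"
  have U [measurable]: "U \<in> borel_measurable ((\<mu>2 \<Otimes>\<^sub>M \<mu>1) \<Otimes>\<^sub>M \<rho>)"
    unfolding U_def by measurable
  define \<mu> where "\<mu> = distr ((\<mu>2 \<Otimes>\<^sub>M \<mu>1) \<Otimes>\<^sub>M \<rho>) borel U"
  define G where "G s t = (\<integral>\<^sup>+ w. ennreal (1 / (1 + \<bar>weighted_mean s t w\<bar>)) \<partial>\<rho>)" for s t
  define r where "r s t = (1 + \<bar>s\<bar>) powr - \<alpha> * (1 + \<bar>t\<bar>) powr - (1 - \<alpha>)" for s t :: real
  \<comment> \<open>The three summands serve equal signs, |s| < a and |t| < a. The last two combine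
    the doubled constants of \<open>Qfun_le\<close> and \<open>Qfun_le'\<close> with the cost of
    inserting the missing power of 1 + |s| or 1 + |t|.\<close>
  define K where "K = 1 + 2 / \<alpha> * (1 + a) powr \<alpha> + 2 / (1 - \<alpha>) * (1 + a) powr (1 - \<alpha>)"
  have K: "1 \<le> K" "2 / \<alpha> * (1 + a) powr \<alpha> \<le> K" "2 / (1 - \<alpha>) * (1 + a) powr (1 - \<alpha>) \<le> K"
    using \<alpha> by (auto simp: K_def)
  \<comment> \<open>The Lebesgue form of Q is jointly measurable in s and t as a parametrised
    integral.\<close>
  define q where "q s t = (\<integral>\<^sup>+ \<tau>. ennreal (Q_integrand \<alpha> \<bar>s\<bar> \<bar>t\<bar> \<tau>) * indicator {0..1} \<tau> \<partial>lborel)" for s t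
  have q: "ennreal (Qfun \<alpha> \<bar>s\<bar> \<bar>t\<bar>) = q s t" for s t
    unfolding q_def by (rule ennreal_Qfun) auto
  have q_meas [measurable]: "(\<lambda>p. q (snd p) (fst p)) \<in> borel_measurable (\<mu>2 \<Otimes>\<^sub>M \<mu>1)"
    unfolding q_def by measurable
  have r0: "0 \<le> r s t" for s t by (simp add: r_def)
  have small: "2 * q s t \<le> ennreal (K * r s t)" if "\<bar>s\<bar> < a \<or> \<bar>t\<bar> < a" for s t
  proof -
    have "2 * Qfun \<alpha> \<bar>s\<bar> \<bar>t\<bar> \<le> K * r s t"
      using that
    proof
      assume s: "\<bar>s\<bar> < a"
      have "1 \<le> (1 + a) powr \<alpha> * (1 + \<bar>s\<bar>) powr - \<alpha>"
        using s \<alpha> powr_mono2[of \<alpha> "1 + \<bar>s\<bar>" "1 + a"] by (simp add: powr_minus_divide)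
      then have "1 * (2 / \<alpha> * (1 + \<bar>t\<bar>) powr - (1 - \<alpha>)) \<le>
        (1 + a) powr \<alpha> * (1 + \<bar>s\<bar>) powr - \<alpha> * (2 / \<alpha> * (1 + \<bar>t\<bar>) powr - (1 - \<alpha>))"
        using \<alpha> by (intro mult_right_mono) auto
      also have "\<dots> = 2 / \<alpha> * (1 + a) powr \<alpha> * r s t" by (simp add: r_def)
      also have "\<dots> \<le> K * r s t" using K r0 by (intro mult_right_mono)
      finally show ?thesis using Qfun_le[OF \<alpha>, of "\<bar>s\<bar>" "\<bar>t\<bar>"] by simp
    next
      assume t: "\<bar>t\<bar> < a"
      have "1 \<le> (1 + a) powr (1 - \<alpha>) * (1 + \<bar>t\<bar>) powr - (1 - \<alpha>)"
        using t \<alpha> powr_mono2[of "1 - \<alpha>" "1 + \<bar>t\<bar>" "1 + a"] powr_minus_divide[of "1 + \<bar>t\<bar>" "1 - \<alpha>"] by simp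
      then have "1 * (2 / (1 - \<alpha>) * (1 + \<bar>s\<bar>) powr - \<alpha>) \<le>
        (1 + a) powr (1 - \<alpha>) * (1 + \<bar>t\<bar>) powr - (1 - \<alpha>) * (2 / (1 - \<alpha>) * (1 + \<bar>s\<bar>) powr - \<alpha>)"
        using \<alpha> by (intro mult_right_mono) auto
      also have "\<dots> = 2 / (1 - \<alpha>) * (1 + a) powr (1 - \<alpha>) * r s t" by (simp add: r_def)
      also have "\<dots> \<le> K * r s t" using K r0 by (intro mult_right_mono)
      finally show ?thesis using Qfun_le'[OF \<alpha>, of "\<bar>s\<bar>" "\<bar>t\<bar>"] by simp
    qed
    then have "ennreal (2 * Qfun \<alpha> \<bar>s\<bar> \<bar>t\<bar>) \<le> ennreal (K * r s t)" by (rule ennreal_leI)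
    then show ?thesis unfolding q[symmetric] by (simp add: ennreal_mult')
  qed
  let ?I1 = "\<lambda>p. indicator {a..} (fst p) * (indicator {..-a} (snd p) * q (snd p) (fst p)) :: ennreal"
  let ?I2 = "\<lambda>p. indicator {..-a} (fst p) * (indicator {a..} (snd p) * q (snd p) (fst p)) :: ennreal"
  have G_le: "G s t \<le> ennreal K * ennreal (r s t) + (2 * ?I1 (t, s) + 2 * ?I2 (t, s))" for s t
  proof -
    \<comment> \<open>If the signs differ and neither |s| nor |t| is below a, then (s, t) lies in
      one of the two quadrants covered by the hypotheses.\<close>
    consider "0 \<le> s \<and> 0 \<le> t \<or> s \<le> 0 \<and> t \<le> 0" | "\<bar>s\<bar> < a \<or> \<bar>t\<bar> < a"
      | "a \<le> t \<and> s \<le> - a" | "t \<le> - a \<and> a \<le> s"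
      using a by linarith
    then show ?thesis
    proof cases
      case 1
      have "G s t = ennreal (1 * r s t)"
        unfolding G_def r_def using R.nn_integral_weighted_mean_same_sign[OF 1] by simp
      also have "\<dots> \<le> ennreal (K * r s t)" using K r0 by (intro ennreal_leI mult_right_mono)
      also have "\<dots> = ennreal K * ennreal (r s t)" using K r0 by (simp add: ennreal_mult)
      finally show ?thesis by (rule add_increasing2[rotated]) simp
    next
      case 2
      have "G s t \<le> 2 * q s t"
        unfolding G_def q[symmetric] by (rule R.nn_integral_weighted_mean_le_Qfun)
      also have "\<dots> \<le> ennreal (K * r s t)" by (rule small[OF 2])
      also have "\<dots> = ennreal K * ennreal (r s t)" using K r0 by (simp add: ennreal_mult)
      finally show ?thesis by (rule add_increasing2[rotated]) simp
    next
      case 3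
      have "G s t \<le> 2 * q s t"
        unfolding G_def q[symmetric] by (rule R.nn_integral_weighted_mean_le_Qfun)
      also have "\<dots> = 2 * ?I1 (t, s)" using 3 by simp
      also have "\<dots> \<le> 2 * ?I1 (t, s) + 2 * ?I2 (t, s)" by simp
      finally show ?thesis by (rule add_increasing[rotated]) simp
    next
      case 4
      have "G s t \<le> 2 * q s t"
        unfolding G_def q[symmetric] by (rule R.nn_integral_weighted_mean_le_Qfun)
      also have "\<dots> = 2 * ?I2 (t, s)" using 4 by simp
      also have "\<dots> \<le> 2 * ?I1 (t, s) + 2 * ?I2 (t, s)" by simp
      finally show ?thesis by (rule add_increasing[rotated]) simp
    qed
  qed
  have I1: "(\<integral>\<^sup>+ p. ?I1 p \<partial>(\<mu>2 \<Otimes>\<^sub>M \<mu>1)) < \<infinity>"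
    using Q1 unfolding q by (subst M2.nn_integral_fst[symmetric]) simp_all
  have I2: "(\<integral>\<^sup>+ p. ?I2 p \<partial>(\<mu>2 \<Otimes>\<^sub>M \<mu>1)) < \<infinity>"
    using Q2 unfolding q by (subst M2.nn_integral_fst[symmetric]) simp_all
  have r_fin: "(\<integral>\<^sup>+ p. ennreal (r (snd p) (fst p)) \<partial>(\<mu>2 \<Otimes>\<^sub>M \<mu>1)) < \<infinity>"
  proof -
    have "(\<integral>\<^sup>+ p. ennreal (r (snd p) (fst p)) \<partial>(\<mu>2 \<Otimes>\<^sub>M \<mu>1))
       = (\<integral>\<^sup>+ t. \<integral>\<^sup>+ s. ennreal ((1 + \<bar>t\<bar>) powr - (1 - \<alpha>)) * ennreal ((1 + \<bar>s\<bar>) powr - \<alpha>) \<partial>\<mu>1 \<partial>\<mu>2)"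
      unfolding r_def
      by (subst M2.nn_integral_fst[symmetric]) (simp_all add: ennreal_mult[symmetric] mult.commute)
    also have "\<dots> = (\<integral>\<^sup>+ t. ennreal ((1 + \<bar>t\<bar>) powr - (1 - \<alpha>)) \<partial>\<mu>2) * (\<integral>\<^sup>+ s. ennreal ((1 + \<bar>s\<bar>) powr - \<alpha>) \<partial>\<mu>1)"
      by (simp add: nn_integral_cmult nn_integral_multc)
    also have "\<dots> < \<infinity>" using fin1 fin2 by (simp add: ennreal_mult_less_top)
    finally show ?thesis .
  qed
  have "(\<integral>\<^sup>+ u. ennreal ((1 + \<bar>u\<bar>) powr - 1) \<partial>\<mu>) = (\<integral>\<^sup>+ q. ennreal ((1 + \<bar>U q\<bar>) powr - 1) \<partial>((\<mu>2 \<Otimes>\<^sub>M \<mu>1) \<Otimes>\<^sub>M \<rho>))"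
    unfolding \<mu>_def by (rule nn_integral_distr) measurable
  also have "\<dots> = (\<integral>\<^sup>+ p. \<integral>\<^sup>+ w. ennreal ((1 + \<bar>U (p, w)\<bar>) powr - 1) \<partial>\<rho> \<partial>(\<mu>2 \<Otimes>\<^sub>M \<mu>1))"
    by (rule R.nn_integral_fst[symmetric]) measurable
  also have "\<dots> = (\<integral>\<^sup>+ p. G (snd p) (fst p) \<partial>(\<mu>2 \<Otimes>\<^sub>M \<mu>1))"
    by (simp add: G_def U_def powr_minus divide_inverse)
  also have "\<dots> \<le> (\<integral>\<^sup>+ p. ennreal K * ennreal (r (snd p) (fst p)) + (2 * ?I1 p + 2 * ?I2 p) \<partial>(\<mu>2 \<Otimes>\<^sub>M \<mu>1))"
    using G_le[of "snd p" "fst p" for p] by (intro nn_integral_mono) simp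
  also have "\<dots> = ennreal K * (\<integral>\<^sup>+ p. ennreal (r (snd p) (fst p)) \<partial>(\<mu>2 \<Otimes>\<^sub>M \<mu>1))
      + (2 * (\<integral>\<^sup>+ p. ?I1 p \<partial>(\<mu>2 \<Otimes>\<^sub>M \<mu>1)) + 2 * (\<integral>\<^sup>+ p. ?I2 p \<partial>(\<mu>2 \<Otimes>\<^sub>M \<mu>1)))"
    unfolding r_def by (simp add: nn_integral_add nn_integral_cmult)
  also have "\<dots> < \<infinity>"
    using r_fin I1 I2 by (simp add: ennreal_mult_less_top)
  finally have \<mu>: "\<mu> \<in> Mplus 1"
    by (simp add: Mplus_def \<mu>_def)
  moreover have "Ctrans \<alpha> \<mu>1 z * Ctrans (1 - \<alpha>) \<mu>2 z = Ctrans 1 \<mu> z" if z: "0 < Im z" for z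
  proof -
    \<comment> \<open>The finiteness obtained by Tonelli supplies the integrability that Fubini
      demands for the complex integrand.\<close>
    have "integrable \<mu> (\<lambda>u. (z + of_real u) powr (- of_real 1))"
      using \<mu> z by (intro Mplus_integrable_powr) auto
    then have int: "integrable ((\<mu>2 \<Otimes>\<^sub>M \<mu>1) \<Otimes>\<^sub>M \<rho>) (\<lambda>q. (z + of_real (U q)) powr (- of_real 1))"
      unfolding \<mu>_def by (subst (asm) integrable_distr_eq) simp_all
    have "Ctrans 1 \<mu> z = (\<integral>q. (z + of_real (U q)) powr (- of_real 1) \<partial>((\<mu>2 \<Otimes>\<^sub>M \<mu>1) \<Otimes>\<^sub>M \<rho>))"
      unfolding Ctrans_def \<mu>_def by (rule integral_distr) measurable
    also have "\<dots> = (\<integral>p. \<integral>w. (z + of_real (U (p, w))) powr (- of_real 1) \<partial>\<rho> \<partial>(\<mu>2 \<Otimes>\<^sub>M \<mu>1))"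
      by (rule T.integral_fst'[OF int, symmetric])
    also have "\<dots> = (\<integral>p. product_kernel \<alpha> z (snd p) (fst p) \<partial>(\<mu>2 \<Otimes>\<^sub>M \<mu>1))"
      using R.Feynman(2)[OF z, of 1] by (simp add: U_def powr_minus divide_inverse)
    also have "\<dots> = Ctrans \<alpha> \<mu>1 z * Ctrans (1 - \<alpha>) \<mu>2 z"
      by (rule product_kernel_integral(2)[OF \<alpha> \<mu>12 z])
    finally show ?thesis ..
  qed
  ultimately show ?thesis by blast
qed

section \<open>The equivalence\<close>

theorem theorem7p10:
  fixes \<alpha> :: real and \<mu>1 \<mu>2 :: "real measure"
  assumes "0 < \<alpha>" and "\<alpha> < 1"
    and "\<mu>1 \<in> Mplus \<alpha>" and "\<mu>2 \<in> Mplus (1 - \<alpha>)"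
  shows "(\<exists>\<mu> \<in> Mplus 1. \<forall>z. Im z > 0 \<longrightarrow>
             Ctrans \<alpha> \<mu>1 z * Ctrans (1 - \<alpha>) \<mu>2 z = Ctrans 1 \<mu> z)
     \<longleftrightarrow>
         (\<exists>a::real. a \<ge> 0 \<and>
            (\<integral>\<^sup>+ t. indicator {a..} t *
               (\<integral>\<^sup>+ s. indicator {..-a} s * ennreal (Qfun \<alpha> \<bar>s\<bar> t) \<partial>\<mu>1) \<partial>\<mu>2) < \<infinity> \<and>
            (\<integral>\<^sup>+ t. indicator {..-a} t *
               (\<integral>\<^sup>+ s. indicator {a..} s * ennreal (Qfun \<alpha> s \<bar>t\<bar>) \<partial>\<mu>1) \<partial>\<mu>2) < \<infinity>)"
    (is "?product \<longleftrightarrow> (\<exists>a. 0 \<le> a \<and> ?J1 a < \<infinity> \<and> ?J2 a < \<infinity>)")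
proof -
  \<comment> \<open>Since a \<ge> 0, the indicators fix the signs of s and t, so both variables can
    be replaced by their absolute values.\<close>
  have J1: "?J1 a = (\<integral>\<^sup>+ t. \<integral>\<^sup>+ s. indicator {a..} t * (indicator {..-a} s * ennreal (Qfun \<alpha> \<bar>s\<bar> \<bar>t\<bar>)) \<partial>\<mu>1 \<partial>\<mu>2)"
    and J2: "?J2 a = (\<integral>\<^sup>+ t. \<integral>\<^sup>+ s. indicator {..-a} t * (indicator {a..} s * ennreal (Qfun \<alpha> \<bar>s\<bar> \<bar>t\<bar>)) \<partial>\<mu>1 \<partial>\<mu>2)"
    if "0 \<le> a" for a
    using that by (auto intro!: nn_integral_cong simp: indicator_def)
  show ?thesis
  proof
    assume ?product
    then obtain \<mu> where \<mu>: "\<mu> \<in> Mplus 1"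
      and eq: "\<And>z. 0 < Im z \<Longrightarrow> Ctrans \<alpha> \<mu>1 z * Ctrans (1 - \<alpha>) \<mu>2 z = Ctrans 1 \<mu> z"
      by blast
    note fin = product_formula_imp_Q_finite[OF assms \<mu> eq]
    \<comment> \<open>The witness is a = 0: both closed quadrants of opposite signs lie in the
      region of \<open>fin\<close>.\<close>
    have "?J1 0 < \<infinity>"
      unfolding J1[OF order_refl]
      by (rule le_less_trans[OF _ fin]) (auto intro!: nn_integral_mono simp: indicator_def)
    moreover have "?J2 0 < \<infinity>"
      unfolding J2[OF order_refl]
      by (rule le_less_trans[OF _ fin]) (auto intro!: nn_integral_mono simp: indicator_def)
    ultimately show "\<exists>a. 0 \<le> a \<and> ?J1 a < \<infinity> \<and> ?J2 a < \<infinity>" by blast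
  next
    assume "\<exists>a. 0 \<le> a \<and> ?J1 a < \<infinity> \<and> ?J2 a < \<infinity>"
    then obtain a where a: "0 \<le> a" and "?J1 a < \<infinity>" "?J2 a < \<infinity>" by blast
    then show ?product
      unfolding J1[OF a] J2[OF a] by (intro Q_finite_imp_product_formula[OF assms a])
  qed
qed

end
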